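(* Let $m\ge1$, $M=\lfloor m/2\rfloor+1$, and let $(q_0,q_0^* )$ be a connected component of $(M,m+1]\setminus\overline{\mathcal U}$ with $q_0>M$. Write $\alpha(q_0)=(a_1\cdots a_n)^\infty$ with $n$ its smallest period, put $c_0^-=a_1\cdots a_n$, $c_0=a_1\cdots a_{n-1}(a_n+1)$ and $c_{\ell+1}=c_\ell\overline{c_\ell}^+$ for $\ell\ge0$. Then $(b_i)\in\mathcal U'_{q_0^*}\setminus\mathcal U'_{q_0}$ if and only if $(b_i)$ or its reflection has the form $$\omega (c_0^-)^j(c_{i_1}\overline{c_{i_1}})^{j_1}(c_{i_1}\overline{c_{i_2}})^{l_1}(c_{i_2}\overline{c_{i_2}})^{j_2}(c_{i_2}\overline{c_{i_3}})^{l_2}\cdots$$ where $\omega$ is a (nonempty, finite) word matched to $a_1\cdots a_n$, $0\le i_1<i_2<\cdots$ are integers, $0\le l_i\le1$, $j\in\{0,\infty\}$ and $0\le j_i\le\infty$ for all $i\ge1$.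
   Context: $\Omega_m=\{0,\dots,m\}$. For $q\in(1,m+1]$, a $q$-expansion of $x\in[0,\frac m{q-1}]$ is $(c_i)\in\Omega_m^{\mathbb N}$ with $x=\sum c_iq^{-i}$; $\mathcal U'_q$ is the set of sequences in $\Omega_m^{\mathbb N}$ that are the unique $q$-expansion of the number they represent. $\mathcal U=\{q\in(1,m+1]:1\text{ has a unique }q\text{-expansion}\}$ and $\overline{\mathcal U}$ is its closure. $\alpha(q)$ is the quasi-greedy expansion of $1$: the lexicographically largest $q$-expansion of $1$ with infinitely many nonzero digits (for such $q_0$ it is periodic). For a word $w=w_1\cdots w_p$: $\overline w=(m-w_1)\cdots(m-w_p)$, $w^+$ increases the last letter by $1$; reflection of a sequence is digitwise $d\mapsto m-d$. For words $v_1\cdots v_p$, $\sigma(v_1\cdots v_p)=v_2\cdots v_p$ and $(v_1\cdots v_p)|_r=v_1\cdots v_r$. A word $u_1\cdots u_p\in\Omega_m^p$ is matched to $a_1\cdots a_n$ if $u_p<m$ and for every $1\le\ell\le p$: $\sigma^\ell(u_1\cdots u_pa_1\cdots a_n)|_n\le a_1\cdots a_n$ whenever $u_1\cdots u_\ell\ne m^\ell$, and $\sigma^\ell(u_1\cdots u_pa_1\cdots a_n)|_n\ge\overline{a_1\cdots a_n}$ whenever $u_1\cdots u_\ell\ne0^\ell$ (lexicographic order). Juxtaposition is concatenation, exponents denote repetition, and if an exponent equals $\infty$ the sequence ends there. *)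

theory Defs
  imports
    "HOL-Analysis.Analysis"
    "HOL-Library.Extended_Nat"
    "HOL-Library.List_Lexorder"
    "HOL-Library.Fun_Lexorder"
    "HOL-Library.Omega_Words_Fun"
begin

text \<open>
  Finite words are lists of natural numbers, compared by the lexicographic order of
  \<open>List_Lexorder\<close>. Sequences are functions on the natural numbers starting at index 0,
  so that \<open>c i\<close> is the digit usually written \<open>c_{i+1}\<close>.
\<close>

definition digit_seqs :: "nat \<Rightarrow> nat word set" where
  "digit_seqs m = {c. \<forall>i. c i \<le> m}"

definition is_expansion :: "nat \<Rightarrow> real \<Rightarrow> nat word \<Rightarrow> real \<Rightarrow> bool" where
  "is_expansion m q c x \<longleftrightarrow>
     c \<in> digit_seqs m \<and> (\<lambda>i. real (c i) / q ^ Suc i) sums x"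

definition unique_expansions :: "nat \<Rightarrow> real \<Rightarrow> nat word set" where
  "unique_expansions m q =
     {c. \<exists>x. is_expansion m q c x \<and> (\<forall>d. is_expansion m q d x \<longrightarrow> d = c)}"

definition univoque_bases :: "nat \<Rightarrow> real set" where
  "univoque_bases m = {q. 1 < q \<and> q \<le> real m + 1 \<and> (\<exists>!c. is_expansion m q c 1)}"

definition infinite_expansion_of_1 :: "nat \<Rightarrow> real \<Rightarrow> nat word \<Rightarrow> bool" where
  "infinite_expansion_of_1 m q c \<longleftrightarrow> is_expansion m q c 1 \<and> infinite {i. c i \<noteq> 0}"

definition quasi_greedy :: "nat \<Rightarrow> real \<Rightarrow> nat word" where
  "quasi_greedy m q =
     (THE c. infinite_expansion_of_1 m q c \<and>
        (\<forall>d. infinite_expansion_of_1 m q d \<longrightarrow> d = c \<or> less_fun d c))"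

definition smallest_period :: "nat word \<Rightarrow> nat" where
  "smallest_period c = (LEAST p. 0 < p \<and> (\<forall>i. c (i + p) = c i))"

definition reflect :: "nat \<Rightarrow> nat list \<Rightarrow> nat list" where
  "reflect m w = map (\<lambda>d. m - d) w"

definition reflect_seq :: "nat \<Rightarrow> nat word \<Rightarrow> nat word" where
  "reflect_seq m c = (\<lambda>i. m - c i)"

definition inc_last :: "nat list \<Rightarrow> nat list" where
  "inc_last w = butlast w @ [last w + 1]"

fun cword :: "nat \<Rightarrow> nat list \<Rightarrow> nat \<Rightarrow> nat list" where
  "cword m a 0 = inc_last a"
| "cword m a (Suc l) = cword m a l @ inc_last (reflect m (cword m a l))"

definition matched :: "nat \<Rightarrow> nat list \<Rightarrow> nat list \<Rightarrow> bool" where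
  "matched m a u \<longleftrightarrow>
     u \<noteq> [] \<and> set u \<subseteq> {0..m} \<and> last u < m \<and>
     (\<forall>l\<in>{1..length u}.
        (take l u \<noteq> replicate l m \<longrightarrow> take (length a) (drop l (u @ a)) \<le> a) \<and>
        (take l u \<noteq> replicate l 0 \<longrightarrow> take (length a) (drop l (u @ a)) \<ge> reflect m a))"

definition power_concat :: "(nat \<Rightarrow> nat list) \<Rightarrow> (nat \<Rightarrow> enat) \<Rightarrow> nat \<Rightarrow> nat list" where
  "power_concat W e k = concat (map (\<lambda>r. concat (replicate (the_enat (e r)) (W r))) [0..<k])"

text \<open>
  The sequence \<open>x\<close> is the infinite juxtaposition of the powers of the words \<open>W 0\<close>, \<open>W 1\<close>, \dots
  with exponents \<open>e 0\<close>, \<open>e 1\<close>, \dots; it ends at the first infinite exponent, if there is one.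
  If there is none, the juxtaposition must have infinite length: for instance, it
  is no sequence at all when all but finitely many exponents vanish.
\<close>

definition is_power_product :: "(nat \<Rightarrow> nat list) \<Rightarrow> (nat \<Rightarrow> enat) \<Rightarrow> nat word \<Rightarrow> bool" where
  "is_power_product W e x \<longleftrightarrow>
     (\<exists>k. e k = \<infinity> \<and> (\<forall>r<k. e r \<noteq> \<infinity>) \<and> x = power_concat W e k \<frown> (W k)\<^sup>\<omega>) \<or>
     (\<forall>r. e r \<noteq> \<infinity>) \<and>
       (\<forall>N. \<exists>k. N < length (power_concat W e k)) \<and>
       (\<forall>k. \<exists>y. x = power_concat W e k \<frown> y)"

text \<open>
  The words and exponents of
  \<open>a^j (c_{i_1} \<sim>c_{i_1})^{j_1} (c_{i_1} \<sim>c_{i_2})^{l_1} (c_{i_2} \<sim>c_{i_2})^{j_2} (c_{i_2} \<sim>c_{i_3})^{l_2} \<dots>\<close>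
  in order, where \<open>\<sim>\<close> is reflection and \<open>a = c_0^-\<close>. Here \<open>ii t\<close>, \<open>jj t\<close>, \<open>ll t\<close> are
  \<open>i_{t+1}\<close>, \<open>j_{t+1}\<close>, \<open>l_{t+1}\<close>: position 0 holds \<open>a^j\<close>, and positions \<open>2 t + 1\<close>,
  \<open>2 t + 2\<close> hold the factors with exponents \<open>jj t\<close>, \<open>ll t\<close>.
\<close>

definition factor_word :: "nat \<Rightarrow> nat list \<Rightarrow> (nat \<Rightarrow> nat) \<Rightarrow> nat \<Rightarrow> nat list" where
  "factor_word m a ii k =
     (case k of
        0 \<Rightarrow> a
      | Suc r \<Rightarrow>
          let t = r div 2 in
          if even r then cword m a (ii t) @ reflect m (cword m a (ii t))
          else cword m a (ii t) @ reflect m (cword m a (ii (Suc t))))"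

definition factor_exponent :: "enat \<Rightarrow> (nat \<Rightarrow> enat) \<Rightarrow> (nat \<Rightarrow> nat) \<Rightarrow> nat \<Rightarrow> enat" where
  "factor_exponent j jj ll k =
     (case k of
        0 \<Rightarrow> j
      | Suc r \<Rightarrow> let t = r div 2 in if even r then jj t else enat (ll t))"

definition has_form :: "nat \<Rightarrow> nat list \<Rightarrow> nat word \<Rightarrow> bool" where
  "has_form m a b \<longleftrightarrow>
     (\<exists>w ii j jj ll x.
        matched m a w \<and> strict_mono ii \<and> j \<in> {0, \<infinity>} \<and> (\<forall>t. ll t \<le> 1) \<and>
        is_power_product (factor_word m a ii) (factor_exponent j jj ll) x \<and>
        b = w \<frown> x)"

end

theory Submission
  imports Defs
begin

text \<open>
  A sequence \<open>c\<close> is a unique \<open>q\<close>-expansion iff every tail following a digit below \<open>m\<close>, and the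
  reflection of every tail following a positive digit, is lexicographically smaller than the
  quasi-greedy expansion of 1. The endpoint \<open>q\<^sub>0\<close> is approached from the left by univoque bases,
  so every reflected shift of \<open>a\<^sup>\<omega>\<close> is smaller than \<open>a\<^sup>\<omega>\<close>. This makes the limit \<open>\<tau>\<close> of
  the words \<open>c\<^sub>\<ell>\<close> the quasi-greedy expansion of a univoque base, and no univoque base has its expansion
  strictly between \<open>a\<^sup>\<omega>\<close> and \<open>\<tau>\<close>, so \<open>\<tau>\<close> is the quasi-greedy expansion of 1 in base \<open>q\<^sub>0\<^sup>*\<close>.

  A sequence in the difference set has a first tail that violates the condition for \<open>a\<^sup>\<omega>\<close> (possibly
  after reflection); the digits before it, together with finitely many leading copies of \<open>a\<close>,
  form the matched word. After \<open>c\<^sub>\<ell>\<close> such a tail can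
  only continue with the reflection of \<open>c\<^sub>\<ell>\<close>, or with its successor, which completes \<open>c\<^sub>\<ell>\<^sub>+\<^sub>1\<close>.
  Hence the tail is an alternating product of words \<open>c\<^sub>f\<close> and reflections of \<open>c\<^sub>g\<close> with
  nondecreasing indices, and grouping equal consecutive pairs gives the exponents.
\<close>

section \<open>The lexicographic order on digit sequences\<close>

text \<open>The sequences to be compared with \<tau> share only finite blocks with it, so bounds on
  blocks are proved inside windows of letters, where a strict inequality survives every
  continuation. Raising a last letter (from \<open>a\<close> to the word of index 0, from a
  reflected word to its successor) turns strict into weak; reflecting the raised letter turns weak
  back into strict. The induction on the index lives on this exchange. Behind a maximal block the
  bounds by \<tau> and by its reflection enclose exactly two words, which differ by one in the last
  letter; this forces the doubling rule. Since tails lie strictly below \<tau>, no tail begins with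
  every block, and therefore the product cannot stall after finitely many letters. The threshold
  \<open>M\<close> makes the first digit exceed \<open>m / 2\<close>, so that a block is larger than
  its reflection at the first letter. The delicate point at \<open>q0\<close> is that \<alpha> might
  equal the reflection of one of its shifts; a univoque base slightly below \<open>q0\<close> rules
  this out. The right endpoint is found by solving for the base in which \<tau> has value 1.\<close>

lemma less_fun_linear: "less_fun x y \<or> x = y \<or> less_fun y x" for x y :: "nat word"
proof (cases "x = y")
  case False
  then have ex: "\<exists>k. x k \<noteq> y k" by auto
  define k where "k = (LEAST k. x k \<noteq> y k)"
  have "x k \<noteq> y k" unfolding k_def using ex by (rule LeastI_ex)
  moreover have "\<forall>j<k. x j = y j" unfolding k_def using not_less_Least by blast
  ultimately show ?thesis unfolding less_fun_def by (metis linorder_neqE_nat)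
qed simp

lemma not_less_fun_trans:
  fixes x y z :: "nat word"
  assumes "\<not> less_fun y x" "\<not> less_fun z y" shows "\<not> less_fun z x"
  using assms less_fun_linear less_fun_trans by blast

lemma not_less_fun_less_fun_trans:
  fixes x y z :: "nat word"
  assumes "\<not> less_fun y x" "less_fun y z" shows "less_fun x z"
  using assms less_fun_linear less_fun_trans by blast

lemma less_fun_suffix_iff:
  fixes x y :: "nat word"
  assumes "\<forall>j<k. x j = y j"
  shows "less_fun (suffix k x) (suffix k y) \<longleftrightarrow> less_fun x y"
proof
  assume "less_fun (suffix k x) (suffix k y)"
  then obtain l where l: "x (k + l) < y (k + l)" "\<forall>j<l. x (k + j) = y (k + j)"
    unfolding less_fun_def by auto
  have "x j = y j" if "j < k + l" for j
    using assms l(2) that by (cases "j < k") (auto dest: spec[of _ "j - k"])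
  with l(1) show "less_fun x y" unfolding less_fun_def by blast
next
  assume "less_fun x y"
  then obtain l where l: "x l < y l" "\<forall>j<l. x j = y j" unfolding less_fun_def by auto
  have "k \<le> l" using assms l(1) by (metis less_irrefl not_le)
  with l have "suffix k x (l - k) < suffix k y (l - k) \<and> (\<forall>j<l - k. suffix k x j = suffix k y j)"
    by auto
  then show "less_fun (suffix k x) (suffix k y)" unfolding less_fun_def by blast
qed

lemma suffix_digit_seqs [simp]: "x \<in> digit_seqs m \<Longrightarrow> suffix k x \<in> digit_seqs m"
  by (simp add: digit_seqs_def)

lemma reflect_seq_digit_seqs [simp]: "reflect_seq m x \<in> digit_seqs m"
  by (simp add: digit_seqs_def reflect_seq_def)

lemma reflect_seq_reflect_seq [simp]: "x \<in> digit_seqs m \<Longrightarrow> reflect_seq m (reflect_seq m x) = x"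
  by (simp add: digit_seqs_def reflect_seq_def fun_eq_iff)

lemma suffix_reflect_seq [simp]: "suffix k (reflect_seq m x) = reflect_seq m (suffix k x)"
  by (simp add: reflect_seq_def fun_eq_iff)

lemma digit_seqsD: "x \<in> digit_seqs m \<Longrightarrow> x i \<le> m"
  by (simp add: digit_seqs_def)

lemma less_fun_reflect_seq:
  assumes "x \<in> digit_seqs m" "y \<in> digit_seqs m"
  shows "less_fun (reflect_seq m x) (reflect_seq m y) \<longleftrightarrow> less_fun y x"
proof -
  have d: "x i \<le> m" "y i \<le> m" for i using assms by (auto simp: digit_seqs_def)
  have "(m - x k < m - y k) = (y k < x k)" "(m - x k = m - y k) = (y k = x k)" for k
    using d[of k] by auto
  then show ?thesis by (simp add: less_fun_def reflect_seq_def)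
qed

text \<open>Agreement of \<open>x\<close> with its shift before position \<open>k\<close> copies the
  digit \<open>m\<close> up to \<open>k\<close>, and then nothing larger can follow.\<close>

lemma not_less_fun_suffix_1:
  assumes "x \<in> digit_seqs m" "x 0 = m"
  shows "\<not> less_fun x (suffix 1 x)"
proof
  assume "less_fun x (suffix 1 x)"
  then obtain k where k: "x k < x (Suc k)" "\<forall>j<k. x j = x (Suc j)"
    unfolding less_fun_def by auto
  have "j \<le> k \<Longrightarrow> x j = m" for j
    by (induction j) (use k(2) assms(2) in auto)
  with k(1) digit_seqsD[OF assms(1), of "Suc k"] show False by auto
qed

text \<open>The conditions for unique expansions are silent behind a digit \<open>m\<close>. This
  carries an upper bound across such a digit and, after reflection, a lower bound across a digit
  0.\<close>

lemma less_fun_suffix_of_top_digit: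
  assumes "x \<in> digit_seqs m" "x k = m" "less_fun (suffix k x) y"
  shows "less_fun (suffix (Suc k) x) y"
proof -
  have "\<not> less_fun (suffix k x) (suffix (Suc k) x)"
    using not_less_fun_suffix_1[of "suffix k x" m] assms(1,2) by simp
  then show ?thesis using assms(3) by (rule not_less_fun_less_fun_trans)
qed

text \<open>
  The quasi-lexicographic condition that characterizes unique expansions when \<open>\<alpha>\<close> is the
  quasi-greedy expansion of 1.
\<close>

definition lex_univoque :: "nat \<Rightarrow> nat word \<Rightarrow> nat word \<Rightarrow> bool" where
  "lex_univoque m \<alpha> c \<longleftrightarrow>
     (\<forall>k. c k < m \<longrightarrow> less_fun (suffix (Suc k) c) \<alpha>) \<and>
     (\<forall>k. 0 < c k \<longrightarrow> less_fun (reflect_seq m (suffix (Suc k) c)) \<alpha>)"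

lemma lex_univoque_reflect_seq:
  assumes "c \<in> digit_seqs m"
  shows "lex_univoque m \<alpha> (reflect_seq m c) \<longleftrightarrow> lex_univoque m \<alpha> c"
proof -
  have "(reflect_seq m c k < m) = (0 < c k)" "(0 < reflect_seq m c k) = (c k < m)" for k
    using digit_seqsD[OF assms, of k] by (auto simp: reflect_seq_def)
  then show ?thesis using assms unfolding lex_univoque_def by auto
qed

section \<open>Values of expansions\<close>

definition expansion_value :: "real \<Rightarrow> nat word \<Rightarrow> real" where
  "expansion_value q c = (\<Sum>i. real (c i) / q ^ Suc i)"

lemma geometric_digit_sums:
  assumes "1 < (q::real)"
  shows "(\<lambda>i. real m / q ^ Suc i) sums (real m / (q - 1))"
proof -
  have "(\<lambda>i. (real m / q) * (1/q)^i) sums ((real m / q) * (1 / (1 - 1/q)))"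
    by (intro sums_mult geometric_sums) (use assms in auto)
  moreover have "(real m / q) * (1 / (1 - 1/q)) = real m / (q - 1)"
    using assms by (simp add: field_simps)
  moreover have "(\<lambda>i. (real m / q) * (1/q)^i) = (\<lambda>i. real m / q ^ Suc i)"
    by (simp add: power_one_over field_simps)
  ultimately show ?thesis by (simp only:)
qed

lemma summable_digits:
  assumes "c \<in> digit_seqs m" "1 < q"
  shows "summable (\<lambda>i. real (c i) / q ^ Suc i)"
proof (rule summable_comparison_test)
  show "\<exists>N. \<forall>n\<ge>N. norm (real (c n) / q ^ Suc n) \<le> real m / q ^ Suc n"
    using assms by (auto simp: digit_seqs_def intro!: divide_right_mono exI[of _ 0])
  show "summable (\<lambda>i. real m / q ^ Suc i)"
    using geometric_digit_sums[OF assms(2)] by (rule sums_summable)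
qed

lemma is_expansion_iff:
  assumes "1 < q"
  shows "is_expansion m q c x \<longleftrightarrow> c \<in> digit_seqs m \<and> expansion_value q c = x"
  unfolding is_expansion_def expansion_value_def
  using summable_digits[OF _ assms] sums_unique summable_sums by metis

lemma expansion_value_split:
  assumes "c \<in> digit_seqs m" "1 < q"
  shows "expansion_value q c =
    (\<Sum>i<k. real (c i) / q ^ Suc i) + expansion_value q (suffix k c) / q ^ k"
proof -
  have "expansion_value q c = (\<Sum>i. real (c (i + k)) / q ^ Suc (i + k)) + (\<Sum>i<k. real (c i) / q ^ Suc i)"
    unfolding expansion_value_def
    using suminf_split_initial_segment[OF summable_digits[OF assms], of k] by simp
  moreover have "(\<Sum>i. real (c (i + k)) / q ^ Suc (i + k)) = (\<Sum>i. real (suffix k c i) / q ^ Suc i / q ^ k)"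
    by (simp add: power_add field_simps)
  moreover have "\<dots> = expansion_value q (suffix k c) / q ^ k"
    unfolding expansion_value_def
    by (rule suminf_divide) (rule summable_digits[OF suffix_digit_seqs[OF assms(1)] assms(2)])
  ultimately show ?thesis by simp
qed

lemma expansion_value_Suc:
  assumes "c \<in> digit_seqs m" "1 < q"
  shows "expansion_value q (suffix k c) = (real (c k) + expansion_value q (suffix (Suc k) c)) / q"
  using expansion_value_split[of "suffix k c" m q 1] assms by (simp add: add_divide_distrib)

lemma expansion_value_nonneg:
  assumes "c \<in> digit_seqs m" "1 < q"
  shows "0 \<le> expansion_value q c"
  unfolding expansion_value_def by (rule suminf_nonneg[OF summable_digits[OF assms]]) (use assms in auto)

lemma expansion_value_pos:
  assumes "c \<in> digit_seqs m" "1 < q" "0 < c k"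
  shows "0 < expansion_value q c"
  unfolding expansion_value_def
  by (rule suminf_pos2[OF summable_digits[OF assms(1,2)], of k]) (use assms in auto)

lemma expansion_value_le:
  assumes "c \<in> digit_seqs m" "1 < q"
  shows "expansion_value q c \<le> real m / (q - 1)"
proof -
  have "(\<Sum>i. real (c i) / q ^ Suc i) \<le> (\<Sum>i. real m / q ^ Suc i)"
    by (rule suminf_le)
      (use assms geometric_digit_sums[OF assms(2)] summable_digits[OF assms] in
        \<open>auto simp: digit_seqs_def sums_iff intro!: divide_right_mono\<close>)
  then show ?thesis
    unfolding expansion_value_def using geometric_digit_sums[OF assms(2), of m] by (simp add: sums_iff)
qed

lemma expansion_value_reflect_seq:
  assumes "c \<in> digit_seqs m" "1 < q"
  shows "expansion_value q (reflect_seq m c) = real m / (q - 1) - expansion_value q c"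
proof -
  have "real (reflect_seq m c i) / q ^ Suc i = real m / q ^ Suc i - real (c i) / q ^ Suc i" for i
    using digit_seqsD[OF assms(1), of i] by (simp add: reflect_seq_def of_nat_diff diff_divide_distrib)
  then show ?thesis
    unfolding expansion_value_def
    using suminf_diff[of "\<lambda>i. real m / q ^ Suc i" "\<lambda>i. real (c i) / q ^ Suc i"]
      geometric_digit_sums[OF assms(2), of m] summable_digits[OF assms]
    by (simp add: sums_iff)
qed

lemma expansion_value_strict_antimono:
  assumes "c \<in> digit_seqs m" "1 < q" "q < q'" "0 < c k"
  shows "expansion_value q' c < expansion_value q c"
proof -
  have s: "summable (\<lambda>i. real (c i) / q ^ Suc i)" "summable (\<lambda>i. real (c i) / q' ^ Suc i)"
    using assms by (auto intro!: summable_digits simp del: power_Suc)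
  have le: "real (c i) / q' ^ Suc i \<le> real (c i) / q ^ Suc i" for i
    by (rule divide_left_mono[OF power_mono]) (use assms in auto)
  have lt: "real (c k) / q' ^ Suc k < real (c k) / q ^ Suc k"
    by (rule divide_strict_left_mono[OF power_strict_mono]) (use assms in auto)
  have "0 < (\<Sum>i. real (c i) / q ^ Suc i - real (c i) / q' ^ Suc i)"
    by (rule suminf_pos2[of _ k]) (use s le lt in \<open>auto intro: summable_diff simp del: power_Suc\<close>)
  then show ?thesis
    unfolding expansion_value_def using suminf_diff[OF s] by simp
qed

lemma expansion_value_diff:
  assumes "c \<in> digit_seqs m" "d \<in> digit_seqs m" "1 < q" "\<forall>i<k. c i = d i"
  shows "expansion_value q c - expansion_value q d =
    (real (c k) + expansion_value q (suffix (Suc k) c)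
      - real (d k) - expansion_value q (suffix (Suc k) d)) / q ^ Suc k"
proof -
  have "(\<Sum>i<k. real (c i) / q ^ Suc i) = (\<Sum>i<k. real (d i) / q ^ Suc i)"
    using assms(4) by simp
  then show ?thesis
    using expansion_value_split[OF assms(1,3), of "Suc k"] expansion_value_split[OF assms(2,3), of "Suc k"]
      assms(3) by (simp add: field_simps)
qed

section \<open>Quasi-greedy expansions\<close>

text \<open>The quasi-greedy algorithm: the digit is the largest one strictly below \<open>q\<close>
  times the remainder, hence the ceiling minus 1 instead of a floor. Strictness keeps all remainders
  positive.\<close>

fun quasi_greedy_rem :: "nat \<Rightarrow> real \<Rightarrow> real \<Rightarrow> nat \<Rightarrow> real" where
  "quasi_greedy_rem m q x 0 = x"
| "quasi_greedy_rem m q x (Suc i) =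
     q * quasi_greedy_rem m q x i - real (min m (nat (\<lceil>q * quasi_greedy_rem m q x i\<rceil> - 1)))"

lemma infinite_expansion_exists:
  assumes q: "1 < q" "q \<le> real m + 1" and x: "0 < x" "x \<le> real m / (q - 1)"
  obtains c where "c \<in> digit_seqs m" "expansion_value q c = x" "infinite {i. c i \<noteq> 0}"
    "\<And>j. c j < m \<Longrightarrow> expansion_value q (suffix (Suc j) c) \<le> 1"
proof -
  define r where "r = quasi_greedy_rem m q x"
  define c where "c i = min m (nat (\<lceil>q * r i\<rceil> - 1))" for i
  have r0: "r 0 = x" and rS: "r (Suc i) = q * r i - real (c i)" for i
    by (simp_all add: r_def c_def)
  \<comment> \<open>\<open>C\<close> is fixed by the map sending x to q x - m, so a digit
    \<open>m\<close> keeps the remainder at most \<open>C\<close>; after a smaller digit the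
    remainder is at most 1, and \<open>1 \<le> C\<close> because
    \<open>q \<le> m + 1\<close>.\<close>
  define C where "C = real m / (q - 1)"
  have C1: "1 \<le> C" using q by (simp add: C_def field_simps)
  have qC: "q * C - real m = C" using q by (simp add: C_def field_simps)
  have step: "0 < r (Suc i) \<and> r (Suc i) \<le> C \<and> (c i < m \<longrightarrow> r (Suc i) \<le> 1)"
    if "0 < r i" "r i \<le> C" for i
  proof -
    have pos: "0 < q * r i" using that q by simp
    then have k0: "0 \<le> \<lceil>q * r i\<rceil> - 1" by (metis add_0 less_ceiling_iff of_int_0 zle_diff1_eq zero_less_ceiling diff_ge_0_iff_ge int_one_le_iff_zero_less)
    have lt: "real_of_int (\<lceil>q * r i\<rceil> - 1) < q * r i" by linarith
    have le: "q * r i \<le> real_of_int (\<lceil>q * r i\<rceil> - 1) + 1" by linarith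
    have eq: "real (nat (\<lceil>q * r i\<rceil> - 1)) = real_of_int (\<lceil>q * r i\<rceil> - 1)" using k0 by simp
    have "real (c i) \<le> real (nat (\<lceil>q * r i\<rceil> - 1))" unfolding c_def by linarith
    then have p: "0 < r (Suc i)" using rS[of i] eq lt by linarith
    have s: "c i < m \<longrightarrow> r (Suc i) \<le> 1" using rS[of i] eq le unfolding c_def by auto
    have "c i = m \<Longrightarrow> r (Suc i) \<le> q * C - real m"
      using rS[of i] that(2) q by (simp add: mult_left_mono)
    moreover have "c i \<le> m" unfolding c_def by simp
    ultimately have "r (Suc i) \<le> C" using qC s C1 by (cases "c i = m") auto
    with p s show ?thesis by simp
  qed
  have inv: "0 < r i \<and> r i \<le> C" for i
    by (induction i) (use r0 x step in \<open>auto simp: C_def\<close>)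
  have dig: "c \<in> digit_seqs m" by (simp add: digit_seqs_def c_def)
  have part: "(\<Sum>i<k. real (c i) / q ^ Suc i) = x - r k / q ^ k" for k
  proof (induction k)
    case 0 then show ?case using r0 by simp
  next
    case (Suc k)
    have "r k / q ^ k = (q * r k) / q ^ Suc k" using q by simp
    then show ?case using Suc by (simp add: rS diff_divide_distrib)
  qed
  have "(\<lambda>k. r k / q ^ k) \<longlonglongrightarrow> 0"
  proof (rule tendsto_sandwich[of "\<lambda>_. 0" _ _ "\<lambda>k. C / q ^ k"])
    show "\<forall>\<^sub>F n in sequentially. r n / q ^ n \<le> C / q ^ n"
      using inv q by (intro always_eventually allI divide_right_mono) auto
    have "(\<lambda>k. C * (1/q) ^ k) \<longlonglongrightarrow> 0"
      using q by (intro tendsto_mult_right_zero LIMSEQ_realpow_zero) auto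
    then show "(\<lambda>k. C / q ^ k) \<longlonglongrightarrow> 0" by (simp add: power_one_over)
  qed (use inv q in \<open>auto intro!: always_eventually simp: less_imp_le\<close>)
  then have "(\<lambda>k. x - r k / q ^ k) \<longlonglongrightarrow> x - 0" by (intro tendsto_intros)
  then have "(\<lambda>i. real (c i) / q ^ Suc i) sums x"
    unfolding sums_def part[symmetric] by simp
  then have val: "expansion_value q c = x" by (simp add: expansion_value_def sums_iff)
  have tail: "expansion_value q (suffix k c) = r k" for k
    using expansion_value_split[OF dig q(1), of k] part[of k] val q by simp
  have "infinite {i. c i \<noteq> 0}"
  proof
    assume "finite {i. c i \<noteq> 0}"
    then obtain N where N: "\<And>i. c i \<noteq> 0 \<Longrightarrow> i < N"
      by (metis (mono_tags, lifting) bounded_nat_set_is_finite finite_nat_set_iff_bounded mem_Collect_eq)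
    have "suffix N c i = 0" for i using N[of "N + i"] by auto
    then have "expansion_value q (suffix N c) = 0" by (simp add: expansion_value_def)
    with tail[of N] inv[of N] show False by simp
  qed
  with dig val tail step inv show ?thesis using that[of c] by auto
qed

lemma expansion_exists:
  assumes "1 < q" "q \<le> real m + 1" "0 \<le> x" "x \<le> real m / (q - 1)"
  obtains c where "c \<in> digit_seqs m" "expansion_value q c = x"
proof (cases "x = 0")
  case True
  have "expansion_value q (\<lambda>_. 0) = 0" by (simp add: expansion_value_def)
  then show ?thesis using True that[of "\<lambda>_. 0"] by (simp add: digit_seqs_def)
next
  case False
  then show ?thesis using infinite_expansion_exists[of q m x] assms that
    by (metis less_eq_real_def)
qed

lemma infinite_nonzero_suffix:
  assumes "infinite {i. c i \<noteq> (0::nat)}"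
  obtains j where "0 < suffix k c j"
proof -
  obtain i where "k \<le> i" "c i \<noteq> 0" using assms by (auto simp: infinite_nat_iff_unbounded_le)
  then have "0 < suffix k c (i - k)" by simp
  then show ?thesis by (rule that)
qed

text \<open>At the first difference \<open>c\<close> gains at least 1, while the tail of
  \<open>\<alpha>\<close> is worth at most 1. A nonzero digit left in \<open>c\<close> makes the
  gain strict.\<close>

lemma expansion_value_mono_lex:
  assumes "\<alpha> \<in> digit_seqs m" "c \<in> digit_seqs m" "1 < q" "less_fun \<alpha> c"
    and tail: "\<And>j. \<alpha> j < m \<Longrightarrow> expansion_value q (suffix (Suc j) \<alpha>) \<le> 1"
  shows "expansion_value q \<alpha> \<le> expansion_value q c"
    and "infinite {i. c i \<noteq> 0} \<Longrightarrow> expansion_value q \<alpha> < expansion_value q c"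
proof -
  obtain k where k: "\<alpha> k < c k" "\<forall>j<k. c j = \<alpha> j" using assms(4) unfolding less_fun_def by auto
  have "\<alpha> k < m" using k(1) digit_seqsD[OF assms(2), of k] by simp
  then have t: "expansion_value q (suffix (Suc k) \<alpha>) \<le> 1" by (rule tail)
  have k1: "real (\<alpha> k) + 1 \<le> real (c k)" using k(1) by linarith
  note diff = expansion_value_diff[OF assms(2,1,3) k(2)]
  have "0 \<le> expansion_value q (suffix (Suc k) c)"
    by (rule expansion_value_nonneg[of _ m]) (use assms in auto)
  then have "0 \<le> expansion_value q c - expansion_value q \<alpha>"
    unfolding diff using t k1 assms(3) by simp
  then show "expansion_value q \<alpha> \<le> expansion_value q c" by simp
  assume "infinite {i. c i \<noteq> 0}"
  then obtain j where "0 < suffix (Suc k) c j" by (rule infinite_nonzero_suffix)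
  then have "0 < expansion_value q (suffix (Suc k) c)"
    using expansion_value_pos[of "suffix (Suc k) c" m q j] assms by simp
  then have "0 < expansion_value q c - expansion_value q \<alpha>"
    unfolding diff using t k1 assms(3) by simp
  then show "expansion_value q \<alpha> < expansion_value q c" by simp
qed

text \<open>
  The excess over 1 of the value of an admissible tail is at most \<open>1/q\<close> times the
  excess of a later admissible tail; being bounded, it cannot be positive.
\<close>

lemma expansion_value_le_1:
  assumes "\<alpha> \<in> digit_seqs m" "d \<in> digit_seqs m" "1 < q" "expansion_value q \<alpha> = 1"
    and lex: "\<And>k. d k < m \<Longrightarrow> \<not> less_fun \<alpha> (suffix (Suc k) d)"
    and j: "\<not> less_fun \<alpha> (suffix j d)"
  shows "expansion_value q (suffix j d) \<le> 1"
    and "less_fun (suffix j d) \<alpha> \<Longrightarrow> infinite {i. \<alpha> i \<noteq> 0} \<Longrightarrow> expansion_value q (suffix j d) < 1"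
proof -
  define C where "C = real m / (q - 1)"
  have C0: "0 \<le> C" using assms(3) by (simp add: C_def)
  have bound: "\<forall>j. \<not> less_fun \<alpha> (suffix j d) \<longrightarrow> expansion_value q (suffix j d) - 1 \<le> C / q ^ n" for n
  proof (induction n)
    case 0
    have "expansion_value q (suffix j d) \<le> C" for j
      unfolding C_def by (rule expansion_value_le) (use assms in auto)
    then have "expansion_value q (suffix j d) - 1 \<le> C" for j
      by (meson diff_le_eq le_add_same_cancel1 order_trans zero_le_one)
    then show ?case unfolding power_0 div_by_1 by blast
  next
    case (Suc n)
    show ?case
    proof (intro allI impI)
      fix j assume nl: "\<not> less_fun \<alpha> (suffix j d)"
      show "expansion_value q (suffix j d) - 1 \<le> C / q ^ Suc n"
      proof (cases "suffix j d = \<alpha>")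
        case True
        then show ?thesis using C0 assms(3,4) by simp
      next
        case False
        then have "less_fun (suffix j d) \<alpha>" using nl less_fun_linear by blast
        then obtain k where k: "d (j + k) < \<alpha> k" "\<forall>i<k. suffix j d i = \<alpha> i"
          unfolding less_fun_def by auto
        have "d (j + k) < m" using k(1) digit_seqsD[OF assms(1), of k] by simp
        then have "\<not> less_fun \<alpha> (suffix (Suc (j + k)) d)" by (rule lex)
        then have v: "expansion_value q (suffix (Suc (j + k)) d) - 1 \<le> C / q ^ n" using Suc.IH by blast
        have v': "0 \<le> expansion_value q (suffix (Suc k) \<alpha>)"
          by (rule expansion_value_nonneg[of _ m]) (use assms in auto)
        have "real (d (j + k)) + 1 \<le> real (\<alpha> k)" using k(1) by linarith
        then have "expansion_value q (suffix j d) - expansion_value q \<alpha> \<le> (C / q ^ n) / q ^ Suc k"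
          unfolding expansion_value_diff[OF suffix_digit_seqs[OF assms(2)] assms(1,3) k(2)]
          using v v' assms(3) by (intro divide_right_mono) auto
        also have "\<dots> \<le> (C / q ^ n) / q ^ Suc 0"
          by (rule divide_left_mono[OF power_increasing]) (use C0 assms(3) in auto)
        finally show ?thesis using assms(4) by (simp add: field_simps)
      qed
    qed
  qed
  have le1: "expansion_value q (suffix j d) \<le> 1" if "\<not> less_fun \<alpha> (suffix j d)" for j
  proof -
    have "(\<lambda>n. C * (1/q) ^ n) \<longlonglongrightarrow> 0"
      using assms(3) by (intro tendsto_mult_right_zero LIMSEQ_realpow_zero) auto
    then have "(\<lambda>n. C / q ^ n) \<longlonglongrightarrow> 0" by (simp add: power_one_over)
    then have "expansion_value q (suffix j d) - 1 \<le> 0"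
      by (rule LIMSEQ_le_const) (use bound that in auto)
    then show ?thesis by simp
  qed
  then show "expansion_value q (suffix j d) \<le> 1" using j by blast
  assume "less_fun (suffix j d) \<alpha>" and inf: "infinite {i. \<alpha> i \<noteq> 0}"
  then obtain k where k: "d (j + k) < \<alpha> k" "\<forall>i<k. suffix j d i = \<alpha> i"
    unfolding less_fun_def by auto
  have "d (j + k) < m" using k(1) digit_seqsD[OF assms(1), of k] by simp
  then have v: "expansion_value q (suffix (Suc (j + k)) d) \<le> 1" using lex le1 by blast
  obtain i where "0 < suffix (Suc k) \<alpha> i" using inf by (rule infinite_nonzero_suffix)
  then have v': "0 < expansion_value q (suffix (Suc k) \<alpha>)"
    using expansion_value_pos[of "suffix (Suc k) \<alpha>" m q i] assms by simp
  have "real (d (j + k)) + 1 \<le> real (\<alpha> k)" using k(1) by linarith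
  then have "expansion_value q (suffix j d) - expansion_value q \<alpha> < 0"
    unfolding expansion_value_diff[OF suffix_digit_seqs[OF assms(2)] assms(1,3) k(2)]
    using v v' assms(3) by (intro divide_neg_pos) auto
  then show "expansion_value q (suffix j d) < 1" using assms(4) by simp
qed

text \<open>The bound on tails behind digits below \<open>m\<close> certifies maximality among
  infinite expansions. It is applied to the output of the algorithm and later to \<tau>.\<close>

lemma quasi_greedy_unique:
  assumes "1 < q" "\<alpha> \<in> digit_seqs m" "expansion_value q \<alpha> = 1" "infinite {i. \<alpha> i \<noteq> 0}"
    and "\<And>j. \<alpha> j < m \<Longrightarrow> expansion_value q (suffix (Suc j) \<alpha>) \<le> 1"
  shows "quasi_greedy m q = \<alpha>"
proof -
  have max: "d = \<alpha> \<or> less_fun d \<alpha>" if "infinite_expansion_of_1 m q d" for d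
  proof -
    have d: "d \<in> digit_seqs m" "expansion_value q d = 1" "infinite {i. d i \<noteq> 0}"
      using that assms(1) by (auto simp: infinite_expansion_of_1_def is_expansion_iff)
    have "\<not> less_fun \<alpha> d"
      using expansion_value_mono_lex(2)[OF assms(2) d(1) assms(1) _ assms(5) d(3)] d(2) assms(3) by auto
    then show ?thesis using less_fun_linear by blast
  qed
  have inf: "infinite_expansion_of_1 m q \<alpha>"
    using assms by (auto simp: infinite_expansion_of_1_def is_expansion_iff)
  show ?thesis unfolding quasi_greedy_def
    by (rule the_equality) (use max inf less_fun_asym in blast)+
qed

lemma quasi_greedy_props:
  assumes "1 < q" "q \<le> real m + 1"
  shows "quasi_greedy m q \<in> digit_seqs m" "expansion_value q (quasi_greedy m q) = 1"
    "infinite {i. quasi_greedy m q i \<noteq> 0}"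
    "quasi_greedy m q j < m \<Longrightarrow> expansion_value q (suffix (Suc j) (quasi_greedy m q)) \<le> 1"
proof -
  have "1 \<le> real m / (q - 1)" using assms by (simp add: field_simps)
  then obtain c where c: "c \<in> digit_seqs m" "expansion_value q c = 1" "infinite {i. c i \<noteq> 0}"
    "\<And>j. c j < m \<Longrightarrow> expansion_value q (suffix (Suc j) c) \<le> 1"
    using infinite_expansion_exists[OF assms, of 1] by auto
  have "quasi_greedy m q = c" using quasi_greedy_unique[OF assms(1) c] .
  with c show "quasi_greedy m q \<in> digit_seqs m" "expansion_value q (quasi_greedy m q) = 1"
    "infinite {i. quasi_greedy m q i \<noteq> 0}"
    "quasi_greedy m q j < m \<Longrightarrow> expansion_value q (suffix (Suc j) (quasi_greedy m q)) \<le> 1" by auto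
qed

text \<open>Behind a digit below \<open>m\<close> the shift is worth at most 1 and has infinitely
  many nonzero digits, so it cannot be larger; behind \<open>m\<close> shifting does not increase
  the sequence.\<close>

lemma quasi_greedy_suffix_le:
  assumes "1 < q" "q \<le> real m + 1"
  shows "\<not> less_fun (quasi_greedy m q) (suffix j (quasi_greedy m q))"
proof (induction j)
  case 0
  show ?case by (simp add: less_fun_irrefl)
next
  case (Suc j)
  let ?\<alpha> = "quasi_greedy m q"
  note P = quasi_greedy_props[OF assms]
  show ?case
  proof (cases "?\<alpha> j < m")
    case True
    have "infinite {i. suffix (Suc j) ?\<alpha> i \<noteq> 0}"
      unfolding infinite_nat_iff_unbounded_le
    proof
      fix N
      obtain i where "0 < suffix (Suc j + N) ?\<alpha> i" using P(3) by (rule infinite_nonzero_suffix)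
      then show "\<exists>n\<ge>N. n \<in> {i. suffix (Suc j) ?\<alpha> i \<noteq> 0}"
        by (intro exI[of _ "N + i"]) (simp add: add.assoc)
    qed
    then show ?thesis
      using expansion_value_mono_lex(2)[OF P(1) suffix_digit_seqs[OF P(1)] assms(1) _ P(4)] P(2,4) True
      by fastforce
  next
    case False
    then have "?\<alpha> j = m" using digit_seqsD[OF P(1), of j] by simp
    then have "\<not> less_fun (suffix j ?\<alpha>) (suffix (Suc j) ?\<alpha>)"
      using not_less_fun_suffix_1[of "suffix j ?\<alpha>" m] P(1) by simp
    then show ?thesis using Suc.IH not_less_fun_trans by blast
  qed
qed

text \<open>Otherwise \<open>expansion_value_le_1\<close> bounds the expansion for \<open>q'\<close>
  by 1 in base \<open>q\<close>, although lowering the base raises its value above 1.\<close>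

lemma quasi_greedy_strict_mono:
  assumes "1 < q" "q < q'" "q' \<le> real m + 1"
  shows "less_fun (quasi_greedy m q) (quasi_greedy m q')"
proof (rule ccontr)
  let ?\<alpha> = "quasi_greedy m q" and ?\<beta> = "quasi_greedy m q'"
  assume nl: "\<not> less_fun ?\<alpha> ?\<beta>"
  have q: "q \<le> real m + 1" "1 < q'" using assms by auto
  note P = quasi_greedy_props[OF assms(1) q(1)] and Q = quasi_greedy_props[OF q(2) assms(3)]
  obtain k where "0 < suffix 0 ?\<beta> k" using Q(3) by (rule infinite_nonzero_suffix)
  then have "1 < expansion_value q ?\<beta>"
    using expansion_value_strict_antimono[OF Q(1) assms(1,2)] Q(2) by auto
  moreover have "expansion_value q (suffix 0 ?\<beta>) \<le> 1"
    by (rule expansion_value_le_1(1)[OF P(1) Q(1) assms(1) P(2)])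
      (use nl quasi_greedy_suffix_le[OF q(2) assms(3)] not_less_fun_trans in \<open>auto\<close>)
  ultimately show False by simp
qed

section \<open>The lexicographic characterization of unique expansions\<close>

text \<open>Of two expansions the smaller one lags by a full unit at the first difference, and its
  tail, if worth less than 1, cannot make up for it. Reflection reduces to the case that
  \<open>c\<close> is the smaller one.\<close>

lemma lex_univoque_imp_unique:
  assumes "1 < q" "\<alpha> \<in> digit_seqs m" "expansion_value q \<alpha> = 1" "infinite {i. \<alpha> i \<noteq> 0}"
    and c: "c \<in> digit_seqs m" "lex_univoque m \<alpha> c"
    and d: "d \<in> digit_seqs m" "expansion_value q d = expansion_value q c"
  shows "d = c"
proof (rule ccontr)
  have no: False if c: "c \<in> digit_seqs m" "lex_univoque m \<alpha> c"
    and d: "d \<in> digit_seqs m" "expansion_value q d = expansion_value q c" "less_fun c d" for c d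
  proof -
    obtain k where k: "c k < d k" "\<forall>j<k. d j = c j" using d(3) unfolding less_fun_def by auto
    have "less_fun (suffix (Suc k) c) \<alpha>"
      using c k(1) digit_seqsD[OF d(1), of k] by (auto simp: lex_univoque_def)
    then have lt: "expansion_value q (suffix (Suc k) c) < 1"
      using expansion_value_le_1(2)[OF assms(2) c(1) assms(1,3)] c(2) assms(4) less_fun_asym
      unfolding lex_univoque_def by blast
    have "0 \<le> expansion_value q (suffix (Suc k) d)"
      by (rule expansion_value_nonneg[of _ m]) (use assms d in auto)
    moreover have "real (c k) + 1 \<le> real (d k)" using k(1) by linarith
    ultimately have "0 < expansion_value q d - expansion_value q c"
      unfolding expansion_value_diff[OF d(1) c(1) assms(1) k(2)] using lt assms(1) by simp
    then show False using d(2) by simp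
  qed
  assume "d \<noteq> c"
  then consider "less_fun c d" | "less_fun d c" using less_fun_linear by blast
  then show False
  proof cases
    case 1 then show False using no c d by blast
  next
    case 2
    have "less_fun (reflect_seq m c) (reflect_seq m d)" using 2 less_fun_reflect_seq c d by blast
    then show False
      using no[of "reflect_seq m c" "reflect_seq m d"] c d expansion_value_reflect_seq assms(1)
      by (simp add: lex_univoque_reflect_seq)
  qed
qed

text \<open>A tail that is not below the quasi-greedy expansion is worth at least 1. Raising the
  digit before it by one and expanding the value minus 1 afresh gives a second expansion.\<close>

lemma unique_expansion_tail_less:
  assumes q: "1 < q" "q \<le> real m + 1" and c: "c \<in> digit_seqs m"
    and uniq: "\<And>d. d \<in> digit_seqs m \<Longrightarrow> expansion_value q d = expansion_value q c \<Longrightarrow> d = c"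
    and k: "c k < m"
  shows "less_fun (suffix (Suc k) c) (quasi_greedy m q)"
proof (rule ccontr)
  let ?v = "expansion_value q (suffix (Suc k) c)" and ?\<alpha> = "quasi_greedy m q"
  note P = quasi_greedy_props[OF q]
  assume "\<not> ?thesis"
  then have "?\<alpha> = suffix (Suc k) c \<or> less_fun ?\<alpha> (suffix (Suc k) c)" using less_fun_linear by blast
  then have ge: "1 \<le> ?v"
    using expansion_value_mono_lex(1)[OF P(1) suffix_digit_seqs[OF c] q(1) _ P(4)] P(2) by auto
  have "?v \<le> real m / (q - 1)" by (rule expansion_value_le) (use c q in auto)
  then obtain e where e: "e \<in> digit_seqs m" "expansion_value q e = ?v - 1"
    using expansion_exists[of q m "?v - 1"] q ge by auto
  define d where "d = (prefix k c @ [Suc (c k)]) \<frown> e"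
  have dn: "d i = (if i < k then c i else if i = k then Suc (c k) else e (i - Suc k))" for i
    by (auto simp: d_def conc_def nth_append)
  have dd: "d \<in> digit_seqs m" using c e(1) k by (auto simp: digit_seqs_def dn)
  have sd: "suffix (Suc k) d = e" by (auto simp: dn)
  have "expansion_value q d - expansion_value q c = 0"
    by (subst expansion_value_diff[OF dd c q(1), of k]) (use sd e(2) in \<open>auto simp: dn\<close>)
  then have "d = c" using uniq dd by simp
  then show False using dn[of k] by simp
qed

lemma unique_expansions_iff:
  assumes "1 < q" "q \<le> real m + 1"
  shows "c \<in> unique_expansions m q \<longleftrightarrow> c \<in> digit_seqs m \<and> lex_univoque m (quasi_greedy m q) c"
proof
  assume "c \<in> unique_expansions m q"
  then have c: "c \<in> digit_seqs m"
    and uniq: "\<And>d. d \<in> digit_seqs m \<Longrightarrow> expansion_value q d = expansion_value q c \<Longrightarrow> d = c"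
    using assms(1) by (auto simp: unique_expansions_def is_expansion_iff)
  have uniq': "d = reflect_seq m c"
    if "d \<in> digit_seqs m" "expansion_value q d = expansion_value q (reflect_seq m c)" for d
  proof -
    have "reflect_seq m d = c"
      using uniq[of "reflect_seq m d"] that c assms(1) by (simp add: expansion_value_reflect_seq)
    then show ?thesis using that(1) by auto
  qed
  have "less_fun (reflect_seq m (suffix (Suc k) c)) (quasi_greedy m q)" if "0 < c k" for k
  proof -
    have "reflect_seq m c k < m" using that digit_seqsD[OF c, of k] by (simp add: reflect_seq_def)
    then show ?thesis
      using unique_expansion_tail_less[OF assms reflect_seq_digit_seqs uniq', of k] by simp
  qed
  then show "c \<in> digit_seqs m \<and> lex_univoque m (quasi_greedy m q) c"
    using c unique_expansion_tail_less[OF assms c uniq] by (auto simp: lex_univoque_def)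
next
  assume "c \<in> digit_seqs m \<and> lex_univoque m (quasi_greedy m q) c"
  then show "c \<in> unique_expansions m q"
    using lex_univoque_imp_unique[OF assms(1) quasi_greedy_props(1-3)[OF assms]] assms(1)
    by (auto simp: unique_expansions_def is_expansion_iff)
qed

lemma univoque_bases_iff:
  "q \<in> univoque_bases m \<longleftrightarrow>
     1 < q \<and> q \<le> real m + 1 \<and> lex_univoque m (quasi_greedy m q) (quasi_greedy m q)"
proof -
  have "(\<exists>!c. is_expansion m q c 1) \<longleftrightarrow> quasi_greedy m q \<in> unique_expansions m q"
    if "1 < q" "q \<le> real m + 1"
    using quasi_greedy_props[OF that] that by (auto simp: unique_expansions_def is_expansion_iff)
  moreover have "quasi_greedy m q \<in> digit_seqs m" if "1 < q" "q \<le> real m + 1"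
    using quasi_greedy_props[OF that] by auto
  ultimately show ?thesis
    unfolding univoque_bases_def using unique_expansions_iff by blast
qed

section \<open>Comparison of finite prefixes\<close>

text \<open>Strictness must be decided within \<open>L\<close> letters, so that it passes to all
  sequences with the same prefixes.\<close>

definition prefix_less :: "nat \<Rightarrow> nat word \<Rightarrow> nat word \<Rightarrow> bool" where
  "prefix_less L x y \<longleftrightarrow> (\<exists>k<L. x k < y k \<and> (\<forall>j<k. x j = y j))"

definition prefix_eq :: "nat \<Rightarrow> nat word \<Rightarrow> nat word \<Rightarrow> bool" where
  "prefix_eq L x y \<longleftrightarrow> (\<forall>j<L. x j = y j)"

lemma prefix_less_imp_less_fun: "prefix_less L x y \<Longrightarrow> less_fun x y"
  unfolding prefix_less_def less_fun_def by blast

lemma prefix_less_mono: "prefix_less L x y \<Longrightarrow> L \<le> L' \<Longrightarrow> prefix_less L' x y"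
  unfolding prefix_less_def by (meson order_less_le_trans)

lemma prefix_less_linear: "prefix_less L x y \<or> prefix_eq L x y \<or> prefix_less L y x"
proof (induction L)
  case (Suc L)
  then consider "prefix_less L x y" | "prefix_less L y x" | "prefix_eq L x y" by blast
  then show ?case
  proof cases
    case 3
    then show ?thesis
      unfolding prefix_eq_def prefix_less_def
      by (cases "x L" "y L" rule: linorder_cases) (auto simp: less_Suc_eq)
  qed (use prefix_less_mono le_SucI in blast)+
qed (simp add: prefix_eq_def)

lemma not_less_fun_prefix:
  assumes "\<not> less_fun y x" shows "prefix_less L x y \<or> prefix_eq L x y"
  using prefix_less_linear prefix_less_imp_less_fun assms by blast

lemma prefix_less_cong:
  assumes "prefix_less L x y" "prefix_eq L x x'" "prefix_eq L y y'"
  shows "prefix_less L x' y'"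
  using assms unfolding prefix_less_def prefix_eq_def by (metis order_less_trans)

lemma prefix_less_append:
  assumes "prefix_less L x y \<or> prefix_eq L x y" "prefix_less L' (suffix L x) (suffix L y)"
  shows "prefix_less (L + L') x y"
proof (cases "prefix_less L x y")
  case True
  then show ?thesis by (rule prefix_less_mono) simp
next
  case False
  then have eq: "\<forall>j<L. x j = y j" using assms(1) by (simp add: prefix_eq_def)
  obtain k where k: "k < L'" "x (L + k) < y (L + k)" "\<forall>j<k. x (L + j) = y (L + j)"
    using assms(2) unfolding prefix_less_def by auto
  have "x j = y j" if "j < L + k" for j
    using eq k(3) that by (cases "j < L") (auto dest: spec[of _ "j - L"])
  with k show ?thesis unfolding prefix_less_def by (intro exI[of _ "L + k"]) auto
qed

lemma prefix_less_reflect_seq: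
  assumes "x \<in> digit_seqs m" "y \<in> digit_seqs m"
  shows "prefix_less L (reflect_seq m x) (reflect_seq m y) \<longleftrightarrow> prefix_less L y x"
proof -
  have d: "x i \<le> m" "y i \<le> m" for i using assms by (auto simp: digit_seqs_def)
  have "(m - x k < m - y k) = (y k < x k)" "(m - x k = m - y k) = (y k = x k)" for k
    using d[of k] by auto
  then show ?thesis by (simp add: prefix_less_def reflect_seq_def)
qed

text \<open>The price of raising the last letter: strict becomes weak.\<close>

lemma prefix_less_inc_last:
  assumes "prefix_less L x y" "\<forall>j. Suc j < L \<longrightarrow> x' j = x j" "x' (L - 1) \<le> Suc (x (L - 1))"
  shows "prefix_less L x' y \<or> prefix_eq L x' y"
proof -
  obtain k where k: "k < L" "x k < y k" "\<forall>j<k. x j = y j"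
    using assms(1) unfolding prefix_less_def by auto
  have e: "\<forall>j<k. x' j = y j" using k assms(2) by auto
  show ?thesis
  proof (cases "x' k < y k")
    case True
    then show ?thesis using e k(1) unfolding prefix_less_def by blast
  next
    case False
    then have "Suc k = L" using assms(2) k(1,2) by (metis Suc_lessI)
    then have "x' k = y k" using False assms(3) k(2) by auto
    then show ?thesis using e \<open>Suc k = L\<close> unfolding prefix_eq_def by (auto simp: less_Suc_eq)
  qed
qed

text \<open>The gain from lowering the last letter: weak becomes strict. Reflecting a word with a
  raised last letter is such a lowering.\<close>

lemma prefix_less_dec_last:
  assumes "prefix_less L x y \<or> prefix_eq L x y" "0 < L" "\<forall>j. Suc j < L \<longrightarrow> x' j = x j"
    "x' (L - 1) < x (L - 1)"
  shows "prefix_less L x' y"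
proof -
  have le: "x' j \<le> x j" if "j < L" for j
  proof (cases "Suc j < L")
    case False
    then have "j = L - 1" using that by simp
    then show ?thesis using assms(4) by simp
  qed (use assms(3) in auto)
  from assms(1) show ?thesis
  proof
    assume "prefix_less L x y"
    then obtain k where k: "k < L" "x k < y k" "\<forall>j<k. x j = y j" unfolding prefix_less_def by auto
    have "\<forall>j<k. x' j = y j" using k assms(3) by auto
    moreover have "x' k < y k" using le[OF k(1)] k(2) by simp
    ultimately show ?thesis using k(1) unfolding prefix_less_def by blast
  next
    assume "prefix_eq L x y"
    then show ?thesis unfolding prefix_less_def prefix_eq_def
      using assms(2-4) by (intro exI[of _ "L - 1"]) auto
  qed
qed

lemma list_le_iff_prefix:
  assumes "length u = length v"
  shows "u \<le> v \<longleftrightarrow> prefix_less (length u) ((!) u) ((!) v) \<or> prefix_eq (length u) ((!) u) ((!) v)"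
  using assms
proof (induction u v rule: list_induct2)
  case (Cons x u y v)
  have "prefix_less (length (x # u)) ((!) (x # u)) ((!) (y # v)) \<longleftrightarrow>
    x < y \<or> x = y \<and> prefix_less (length u) ((!) u) ((!) v)"
    unfolding prefix_less_def by (auto simp: Ex_less_Suc2 All_less_Suc2)
  moreover have "prefix_eq (length (x # u)) ((!) (x # u)) ((!) (y # v)) \<longleftrightarrow>
    x = y \<and> prefix_eq (length u) ((!) u) ((!) v)"
    unfolding prefix_eq_def by (auto simp: All_less_Suc2)
  ultimately show ?case using Cons by auto
qed (simp add: prefix_eq_def)

section \<open>The words \<open>c\<^sub>\<ell>\<close> and their limit\<close>

text \<open>What the combinatorics uses of the expansion of 1 in base \<open>q0\<close>:
  \<open>suffix_less\<close> is strict because the period is minimal, \<open>first_digit\<close>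
  comes from \<open>q0 > M\<close>, and \<open>reflect_suffix_less\<close> from \<open>q0\<close>
  lying in the closure of the univoque bases with a gap to its right.\<close>

locale admissible_word =
  fixes m :: nat and a :: "nat list"
  assumes nonempty: "a \<noteq> []"
    and digits: "a\<^sup>\<omega> \<in> digit_seqs m"
    and last_less: "last a < m"
    and first_digit: "m < 2 * a ! 0"
    and suffix_less: "\<And>k. 0 < k \<Longrightarrow> k < length a \<Longrightarrow> less_fun (suffix k (a\<^sup>\<omega>)) (a\<^sup>\<omega>)"
    and reflect_suffix_less: "\<And>k. less_fun (reflect_seq m (suffix k (a\<^sup>\<omega>))) (a\<^sup>\<omega>)"
begin

abbreviation "\<alpha> \<equiv> a\<^sup>\<omega>"
abbreviation "n \<equiv> length a"

definition N :: "nat \<Rightarrow> nat" where "N l = n * 2 ^ l"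

text \<open>A diagonal definition: the word of index \<open>i\<close> has more than \<open>i\<close>
  letters and all later words extend it. The result is a sequence of Thue-Morse type.\<close>

definition \<tau> :: "nat word" where "\<tau> i = cword m a i ! i"

lemma n_pos: "0 < n" using nonempty by simp

lemma N_0: "N 0 = n" by (simp add: N_def)
lemma N_Suc: "N (Suc l) = N l + N l" by (simp add: N_def)
lemma N_pos: "0 < N l" using n_pos by (simp add: N_def)
lemma less_N: "i < N i"
proof -
  have "i < 1 * 2 ^ i" by (simp add: less_exp)
  also have "\<dots> \<le> N i" unfolding N_def by (rule mult_right_mono) (use n_pos in linarith)+
  finally show ?thesis .
qed
lemma N_mono: "l \<le> l' \<Longrightarrow> N l \<le> N l'" by (simp add: N_def)

lemma length_inc_last: "w \<noteq> [] \<Longrightarrow> length (inc_last w) = length w"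
  by (simp add: inc_last_def)

lemma length_cword [simp]: "length (cword m a l) = N l"
proof (induction l)
  case (Suc l)
  then have "reflect m (cword m a l) \<noteq> []" using N_pos[of l] by (auto simp: reflect_def)
  then show ?case using Suc by (simp add: length_inc_last reflect_def N_Suc)
qed (use nonempty in \<open>simp add: length_inc_last N_0\<close>)

lemma cword_nth_mono: "l \<le> l' \<Longrightarrow> i < N l \<Longrightarrow> cword m a l' ! i = cword m a l ! i"
proof (induction l' rule: dec_induct)
  case (step l')
  then show ?case using N_mono[of l l'] by (simp add: nth_append)
qed simp

lemma cword_nth: "i < N l \<Longrightarrow> cword m a l ! i = \<tau> i"
  unfolding \<tau>_def using cword_nth_mono[of l i] cword_nth_mono[of i l] less_N by (metis nle_le)

lemma inc_last_nth:
  assumes "w \<noteq> []" "i < length w"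
  shows "inc_last w ! i = (if Suc i = length w then Suc (w ! i) else w ! i)"
proof (cases "Suc i = length w")
  case True
  then have "i = length w - 1" by simp
  then show ?thesis using assms by (simp add: inc_last_def nth_append last_conv_nth)
next
  case False
  then have "i < length w - 1" using assms(2) by simp
  then show ?thesis using assms False by (simp add: inc_last_def nth_append nth_butlast)
qed

lemma \<tau>_base:
  assumes "i < n" shows "\<tau> i = (if Suc i = n then Suc (\<alpha> i) else \<alpha> i)"
  using cword_nth[of i 0] inc_last_nth[OF nonempty, of i] assms n_pos
  by (auto simp: N_0 split: if_splits)

lemma \<tau>_step:
  assumes "i < N l"
  shows "\<tau> (N l + i) = (if Suc i = N l then Suc (m - \<tau> i) else m - \<tau> i)"
proof -
  have "cword m a (Suc l) ! (N l + i) = \<tau> (N l + i)" using assms by (intro cword_nth) (simp add: N_Suc)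
  moreover have "reflect m (cword m a l) \<noteq> []"
    using N_pos[of l] length_cword[of l] by (auto simp: reflect_def simp del: length_cword)
  ultimately show ?thesis
    using assms by (simp add: nth_append inc_last_nth reflect_def cword_nth split: if_splits)
qed

lemma \<alpha>_last: "\<alpha> (n - 1) < m"
  using last_less nonempty by (simp add: last_conv_nth)

text \<open>Since the last letter of each word is positive, the last letter of its reflection can be
  raised without exceeding \<open>m\<close>.\<close>

lemma \<tau>_last_pos: "0 < \<tau> (N l - 1)"
proof (cases l)
  case 0
  then show ?thesis using \<tau>_base[of "n - 1"] n_pos by (simp add: N_0)
next
  case (Suc l')
  then have "N l - 1 = N l' + (N l' - 1)" using N_pos[of l'] by (simp add: N_Suc)
  then show ?thesis using \<tau>_step[of "N l' - 1" l'] N_pos[of l'] by simp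
qed

lemma \<tau>_digits: "\<tau> \<in> digit_seqs m"
proof -
  have "i < N l \<longrightarrow> \<tau> i \<le> m" for i l
  proof (induction l arbitrary: i)
    case 0
    then show ?case using \<tau>_base[of i] \<alpha>_last digit_seqsD[OF digits, of i]
      by (cases "i = n - 1") (auto simp: N_0 simp del: iter_nth)
  next
    case (Suc l)
    show ?case
    proof (cases "i < N l")
      case False
      show ?thesis
      proof
        assume "i < N (Suc l)"
        then have i: "i = N l + (i - N l)" "i - N l < N l" using False by (auto simp: N_Suc)
        show "\<tau> i \<le> m"
          using \<tau>_step[OF i(2)] i(1) \<tau>_last_pos[of l] Suc.IH[of "N l - 1"]
          by (cases "i - N l = N l - 1") auto
      qed
    qed (use Suc in blast)
  qed
  then show ?thesis using less_N by (auto simp: digit_seqs_def)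
qed

section \<open>Lexicographic bounds on the shifts of \<tau> and of its blocks\<close>

lemma \<tau>_first: "m - \<tau> 0 < \<tau> 0" "\<alpha> 0 \<le> \<tau> 0"
proof -
  show "\<alpha> 0 \<le> \<tau> 0" using \<tau>_base[of 0] n_pos by auto
  moreover have "m < 2 * \<alpha> 0" using first_digit n_pos by simp
  ultimately show "m - \<tau> 0 < \<tau> 0" using \<tau>_last_pos[of 0] by linarith
qed

text \<open>Equality on \<open>n - k\<close> letters would make the shift of \<alpha> by
  \<open>n - k\<close> larger than \<alpha>, so the comparison for \<alpha> is strict within the
  window. Raising the last letter weakens it; in the reflected claim that letter is lowered instead,
  which gains strictness.\<close>

lemma window_base:
  assumes "0 < k" "k < n"
  shows "prefix_less (n - k) (suffix k \<tau>) \<tau> \<or> prefix_eq (n - k) (suffix k \<tau>) \<tau>"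
    and "prefix_less (n - k) (reflect_seq m (suffix k \<tau>)) \<tau>"
proof -
  have per: "\<alpha> (n + i) = \<alpha> i" for i using n_pos by simp
  have cong: "prefix_eq (n - k) \<alpha> \<tau>" using assms by (auto simp: prefix_eq_def \<tau>_base)
  have e: "suffix k \<tau> j = suffix k \<alpha> j" if "Suc j < n - k" for j
    using that \<tau>_base[of "k + j"] by simp
  have last: "suffix k \<tau> (n - k - 1) = Suc (suffix k \<alpha> (n - k - 1))"
    using assms \<tau>_base[of "n - 1"] by simp
  have "\<not> prefix_eq (n - k) (suffix k \<alpha>) \<alpha>"
  proof
    assume eq: "prefix_eq (n - k) (suffix k \<alpha>) \<alpha>"
    have "less_fun (suffix (n - k) (suffix k \<alpha>)) (suffix (n - k) \<alpha>)"
      by (subst less_fun_suffix_iff) (use eq suffix_less assms in \<open>auto simp: prefix_eq_def\<close>)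
    moreover have "suffix (n - k) (suffix k \<alpha>) = \<alpha>" using assms per by (auto simp: fun_eq_iff)
    ultimately have "less_fun \<alpha> (suffix (n - k) \<alpha>)" by (simp only:)
    moreover have "less_fun (suffix (n - k) \<alpha>) \<alpha>" by (rule suffix_less) (use assms in auto)
    ultimately show False using less_fun_asym by blast
  qed
  then have "prefix_less (n - k) (suffix k \<alpha>) \<alpha>"
    using not_less_fun_prefix less_fun_asym suffix_less assms by blast
  then have "prefix_less (n - k) (suffix k \<tau>) \<alpha> \<or> prefix_eq (n - k) (suffix k \<tau>) \<alpha>"
    by (rule prefix_less_inc_last) (use e last in auto)
  then show "prefix_less (n - k) (suffix k \<tau>) \<tau> \<or> prefix_eq (n - k) (suffix k \<tau>) \<tau>"
    using cong unfolding prefix_less_def prefix_eq_def by (metis order_less_trans)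
  have "prefix_less (n - k) (reflect_seq m (suffix k \<alpha>)) \<alpha> \<or> prefix_eq (n - k) (reflect_seq m (suffix k \<alpha>)) \<alpha>"
    using not_less_fun_prefix less_fun_asym reflect_suffix_less by blast
  then have "prefix_less (n - k) (reflect_seq m (suffix k \<tau>)) \<alpha>"
    by (rule prefix_less_dec_last)
      (use e last assms \<alpha>_last in \<open>auto simp: reflect_seq_def simp del: iter_nth\<close>)
  then show "prefix_less (n - k) (reflect_seq m (suffix k \<tau>)) \<tau>"
    by (rule prefix_less_cong) (use cong in \<open>auto simp: prefix_eq_def\<close>)
qed

text \<open>Induction on the doubling. A shift into the first half joins the weak bound on the rest
  of that half to a strict bound on the letters behind it. A shift inside the second half is a
  reflected shift of the first half, so the two claims exchange roles up to the raised last
  letter.\<close>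

lemma window:
  "0 < k \<Longrightarrow> k < N l \<Longrightarrow>
    (prefix_less (N l - k) (suffix k \<tau>) \<tau> \<or> prefix_eq (N l - k) (suffix k \<tau>) \<tau>) \<and>
    prefix_less (N l - k) (reflect_seq m (suffix k \<tau>)) \<tau>"
proof (induction l arbitrary: k)
  case 0
  then show ?case unfolding N_0 using window_base by blast
next
  case (Suc l)
  let ?L = "N (Suc l) - k"
  have NS: "N (Suc l) = N l + N l" by (rule N_Suc)
  consider "k < N l" | "k = N l" | "N l < k" by linarith
  then show ?case
  proof cases
    case 1
    have IH: "prefix_less (N l - k) (suffix k \<tau>) \<tau> \<or> prefix_eq (N l - k) (suffix k \<tau>) \<tau>"
      "prefix_less (N l - k) (reflect_seq m (suffix k \<tau>)) \<tau>"
      using Suc.IH[OF Suc.prems(1) 1] by blast+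
    \<comment> \<open>The \<open>k\<close> letters behind the first half are those of reflected
      \<tau> and must be compared with \<tau> from \<open>N l - k\<close> on: this is the reflected
      claim at the complementary shift. As \<open>k < N l\<close>, the raised letter is not
      reached.\<close>
    have "prefix_less k (reflect_seq m (suffix (N l - k) \<tau>)) \<tau>"
      using Suc.IH[of "N l - k"] 1 Suc.prems diff_diff_cancel[of k "N l"]
      by (metis diff_less less_imp_le_nat zero_less_diff)
    then have "prefix_less k (reflect_seq m \<tau>) (suffix (N l - k) \<tau>)"
      using prefix_less_reflect_seq[of "\<tau>" m "reflect_seq m (suffix (N l - k) \<tau>)" k] \<tau>_digits by simp
    then have "prefix_less k (suffix (N l) \<tau>) (suffix (N l - k) \<tau>)"
      by (rule prefix_less_cong) (use \<tau>_step 1 in \<open>auto simp: prefix_eq_def reflect_seq_def\<close>)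
    then have "prefix_less (N l - k + k) (suffix k \<tau>) \<tau>"
      by (intro prefix_less_append) (use IH 1 in auto)
    then have "prefix_less ?L (suffix k \<tau>) \<tau>" by (rule prefix_less_mono) (use 1 in \<open>simp add: NS\<close>)
    moreover have "prefix_less ?L (reflect_seq m (suffix k \<tau>)) \<tau>"
      by (rule prefix_less_mono[OF IH(2)]) (use 1 in \<open>simp add: NS\<close>)
    ultimately show ?thesis by blast
  next
    case 2
    have L: "?L = N l" using 2 by (simp add: NS)
    show ?thesis
    proof
      show "prefix_less ?L (suffix k \<tau>) \<tau> \<or> prefix_eq ?L (suffix k \<tau>) \<tau>"
      \<comment> \<open>A block of one letter consists of the raised letter alone, so a tie with
        \<open>\<tau> 0\<close> is possible; in longer blocks the first letter decides.\<close>
      proof (cases "N l = 1")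
        case True
        then show ?thesis using 2 L \<tau>_step[of 0 l] \<tau>_first(1)
          by (auto simp: prefix_less_def prefix_eq_def)
      next
        case False
        then show ?thesis using 2 L \<tau>_step[of 0 l] \<tau>_first(1) N_pos[of l]
          by (auto simp: prefix_less_def)
      qed
      have "prefix_less (N l) (reflect_seq m (suffix k \<tau>)) \<tau>"
      proof (rule prefix_less_dec_last[of _ \<tau>])
        show "reflect_seq m (suffix k \<tau>) (N l - 1) < \<tau> (N l - 1)"
          using 2 \<tau>_step[of "N l - 1" l] N_pos[of l] \<tau>_last_pos[of l] digit_seqsD[OF \<tau>_digits, of "N l - 1"]
          by (simp add: reflect_seq_def)
        show "\<forall>j. Suc j < N l \<longrightarrow> reflect_seq m (suffix k \<tau>) j = \<tau> j"
          using 2 \<tau>_step[of _ l] digit_seqsD[OF \<tau>_digits] by (auto simp: reflect_seq_def)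
      qed (use N_pos in \<open>auto simp: prefix_eq_def\<close>)
      then show "prefix_less ?L (reflect_seq m (suffix k \<tau>)) \<tau>" unfolding L .
    qed
  next
    case 3
    define k' where "k' = k - N l"
    have k': "0 < k'" "k' < N l" "k = N l + k'" "?L = N l - k'"
      using 3 Suc.prems by (auto simp: k'_def NS)
    have IH: "prefix_less (N l - k') (suffix k' \<tau>) \<tau> \<or> prefix_eq (N l - k') (suffix k' \<tau>) \<tau>"
      "prefix_less (N l - k') (reflect_seq m (suffix k' \<tau>)) \<tau>"
      using Suc.IH[OF k'(1,2)] by blast+
    have e: "suffix k \<tau> j = m - suffix k' \<tau> j" if "Suc j < ?L" for j
      using that k' \<tau>_step[of "k' + j" l] by (simp add: add.assoc)
    have last: "suffix k \<tau> (?L - 1) = Suc (m - suffix k' \<tau> (?L - 1))"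
      using k' \<tau>_step[of "N l - 1" l] by (simp add: add.assoc)
    show ?thesis
    proof
      show "prefix_less ?L (suffix k \<tau>) \<tau> \<or> prefix_eq ?L (suffix k \<tau>) \<tau>"
        by (rule prefix_less_inc_last[of _ "reflect_seq m (suffix k' \<tau>)"])
          (use IH k' e last in \<open>auto simp: reflect_seq_def\<close>)
      have "suffix k' \<tau> (?L - 1) = \<tau> (N l - 1)" using k' by simp
      then show "prefix_less ?L (reflect_seq m (suffix k \<tau>)) \<tau>"
        by (intro prefix_less_dec_last[of _ "suffix k' \<tau>"])
          (use IH k' e last digit_seqsD[OF \<tau>_digits] \<tau>_last_pos[of l] in \<open>auto simp: reflect_seq_def\<close>)
    qed
  qed
qed

text \<open>Transfers \<open>window\<close> to sequences that merely begin with a block and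
  \<open>k\<close> letters of its reflection; after the shift by \<open>k\<close>, these letters
  break a tie on the rest of the block.\<close>

lemma block_suffix_less:
  assumes y: "\<forall>j<N l. y j = \<tau> j" "\<forall>j<k. y (N l + j) = m - \<tau> j" and k: "0 < k" "k < N l"
  shows "less_fun (suffix k y) \<tau>" "less_fun (reflect_seq m (suffix k y)) \<tau>"
proof -
  note W = window[OF k]
  have eq: "prefix_eq (N l - k) (suffix k \<tau>) (suffix k y)" using y(1) k by (auto simp: prefix_eq_def)
  then have "prefix_less (N l - k) (reflect_seq m (suffix k y)) \<tau>"
    by (intro prefix_less_cong[OF conjunct2[OF W]]) (auto simp: prefix_eq_def reflect_seq_def)
  then show "less_fun (reflect_seq m (suffix k y)) \<tau>" by (rule prefix_less_imp_less_fun)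
  have W2: "prefix_less k (reflect_seq m (suffix (N l - k) \<tau>)) \<tau>"
    using window[of "N l - k" l] k by simp
  then have "prefix_less k (reflect_seq m \<tau>) (suffix (N l - k) \<tau>)"
    using prefix_less_reflect_seq[of "\<tau>" m "reflect_seq m (suffix (N l - k) \<tau>)" k] \<tau>_digits by simp
  then have "prefix_less k (suffix (N l) y) (suffix (N l - k) \<tau>)"
    by (rule prefix_less_cong) (use y(2) in \<open>auto simp: prefix_eq_def reflect_seq_def\<close>)
  moreover have "prefix_less (N l - k) (suffix k y) \<tau> \<or> prefix_eq (N l - k) (suffix k y) \<tau>"
    using conjunct1[OF W] eq unfolding prefix_less_def prefix_eq_def by (metis order_less_trans)
  ultimately have "prefix_less (N l - k + k) (suffix k y) \<tau>"
    by (intro prefix_less_append) (use k in auto)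
  then show "less_fun (suffix k y) \<tau>" by (rule prefix_less_imp_less_fun)
qed

lemma reflect_seq_less_of_first:
  assumes "y 0 = \<tau> 0" shows "less_fun (reflect_seq m y) \<tau>"
  unfolding less_fun_def by (rule exI[of _ 0]) (use \<tau>_first(1) assms in \<open>simp add: reflect_seq_def\<close>)

text \<open>The choice \<open>l = k\<close> puts the shift inside the first block, because
  \<open>k < N k\<close>, and the next \<open>k\<close> letters stop short of the raised
  one.\<close>

lemma \<tau>_suffix_less: "0 < k \<Longrightarrow> less_fun (suffix k \<tau>) \<tau>"
  by (rule block_suffix_less(1)[where l = k and k = k]) (use \<tau>_step[of _ k] less_N[of k] in auto)

lemma \<tau>_reflect_suffix_less: "less_fun (reflect_seq m (suffix k \<tau>)) \<tau>"
proof (cases "k = 0")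
  case True
  then show ?thesis using reflect_seq_less_of_first[of \<tau>] by simp
next
  case False
  then show ?thesis
    by (intro block_suffix_less(2)[where l = k and k = k]) (use \<tau>_step[of _ k] less_N[of k] in auto)
qed

text \<open>The shift by 0 is now included: a block followed by its full reflection falls short of
  the next block by one in the last letter.\<close>

lemma block_suffix_less':
  assumes y: "\<forall>j<N l. y j = \<tau> j" "\<forall>j<N l. y (N l + j) = m - \<tau> j" and k: "k < N l"
  shows "less_fun (suffix k y) \<tau>" "less_fun (reflect_seq m (suffix k y)) \<tau>"
proof -
  have "less_fun y \<tau>"
    unfolding less_fun_def
  proof (intro exI[of _ "N l + (N l - 1)"] conjI allI impI)
    show "y (N l + (N l - 1)) < \<tau> (N l + (N l - 1))"
      using y(2)[rule_format, of "N l - 1"] \<tau>_step[of "N l - 1" l] N_pos[of l] by simp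
    fix j assume j: "j < N l + (N l - 1)"
    show "y j = \<tau> j"
    proof (cases "j < N l")
      case False
      then show ?thesis using y(2)[rule_format, of "j - N l"] \<tau>_step[of "j - N l" l] j by auto
    qed (use y(1) in blast)
  qed
  moreover have "less_fun (reflect_seq m y) \<tau>"
    using reflect_seq_less_of_first y(1) N_pos by blast
  ultimately show "less_fun (suffix k y) \<tau>" "less_fun (reflect_seq m (suffix k y)) \<tau>"
    using block_suffix_less[OF y(1), of k] y(2) k by (cases "k = 0"; auto)+
qed

lemma \<alpha>_less_\<tau>: "prefix_less n \<alpha> \<tau>"
  unfolding prefix_less_def
  by (rule exI[of _ "n - 1"]) (use n_pos in \<open>auto simp: \<tau>_base simp del: iter_nth\<close>)

end

section \<open>Power products\<close>

lemma power_concat_shift: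
  "power_concat W e (Suc k) =
     concat (replicate (the_enat (e 0)) (W 0)) @ power_concat (\<lambda>r. W (Suc r)) (\<lambda>r. e (Suc r)) k"
proof -
  have "[0..<Suc k] = 0 # map Suc [0..<k]" by (simp add: map_Suc_upt upt_conv_Cons del: upt_Suc)
  then show ?thesis unfolding power_concat_def by (simp add: comp_def del: upt_Suc)
qed

lemma power_concat_Suc:
  "power_concat W e (Suc k) = power_concat W e k @ concat (replicate (the_enat (e k)) (W k))"
  by (simp add: power_concat_def)

lemma power_concat_0 [simp]: "power_concat W e 0 = []"
  by (simp add: power_concat_def)

lemma power_concat_prefix:
  assumes "k \<le> k'" shows "\<exists>u. power_concat W e k' = power_concat W e k @ u"
  using assms by (induction k' rule: dec_induct) (auto simp: power_concat_Suc)

lemma is_power_product_infinity: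
  assumes "e 0 = \<infinity>"
  shows "is_power_product W e x \<longleftrightarrow> x = (W 0)\<^sup>\<omega>"
proof
  assume "is_power_product W e x"
  then obtain k where k: "\<forall>r<k. e r \<noteq> \<infinity>" "x = power_concat W e k \<frown> (W k)\<^sup>\<omega>"
    unfolding is_power_product_def using assms by blast
  then have "k = 0" using assms by (metis gr0I)
  then show "x = (W 0)\<^sup>\<omega>" using k by simp
next
  assume "x = (W 0)\<^sup>\<omega>"
  then show "is_power_product W e x"
    unfolding is_power_product_def using assms by (intro disjI1 exI[of _ 0]) simp
qed

text \<open>Peels off the first factor. Stopping and unending products are treated here once, and a
  given product can then be analysed by shifting \<open>W\<close> and \<open>e\<close>.\<close>

lemma is_power_product_finite:
  assumes "e 0 \<noteq> \<infinity>"
  shows "is_power_product W e x \<longleftrightarrow>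
    (\<exists>y. x = concat (replicate (the_enat (e 0)) (W 0)) \<frown> y \<and>
      is_power_product (\<lambda>r. W (Suc r)) (\<lambda>r. e (Suc r)) y)"
    (is "?L \<longleftrightarrow> (\<exists>y. x = ?u \<frown> y \<and> ?P y)")
proof
  assume ?L
  then consider
    k where "e k = \<infinity>" "\<forall>r<k. e r \<noteq> \<infinity>" "x = power_concat W e k \<frown> (W k)\<^sup>\<omega>"
  | "\<forall>r. e r \<noteq> \<infinity>" "\<forall>N. \<exists>k. N < length (power_concat W e k)" "\<forall>k. \<exists>y. x = power_concat W e k \<frown> y"
    unfolding is_power_product_def by blast
  then show "\<exists>y. x = ?u \<frown> y \<and> ?P y"
  proof cases
    case 1
    then obtain k' where k': "k = Suc k'" using assms by (metis not0_implies_Suc)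
    have "?P (power_concat (\<lambda>r. W (Suc r)) (\<lambda>r. e (Suc r)) k' \<frown> (W (Suc k'))\<^sup>\<omega>)"
      unfolding is_power_product_def by (intro disjI1 exI[of _ k']) (use 1 k' in auto)
    then show ?thesis using 1(3) unfolding k' power_concat_shift conc_conc[symmetric] by blast
  next
    case 2
    obtain y where y: "x = power_concat W e 1 \<frown> y" using 2(3) by blast
    then have xu: "x = ?u \<frown> y" by (simp add: power_concat_shift)
    have "?P y"
      unfolding is_power_product_def
    proof (intro disjI2 conjI allI)
      show "e (Suc r) \<noteq> \<infinity>" for r using 2(1) by blast
      show "\<exists>k. N < length (power_concat (\<lambda>r. W (Suc r)) (\<lambda>r. e (Suc r)) k)" for N
      proof -
        obtain k where k: "length ?u + N < length (power_concat W e k)" using 2(2) by blast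
        then obtain k' where "k = Suc k'" by (cases k) auto
        then show ?thesis using k by (auto simp: power_concat_shift)
      qed
      show "\<exists>z. y = power_concat (\<lambda>r. W (Suc r)) (\<lambda>r. e (Suc r)) k \<frown> z" for k
      proof -
        obtain z where "x = power_concat W e (Suc k) \<frown> z" using 2(3) by blast
        then have "?u \<frown> y = ?u \<frown> (power_concat (\<lambda>r. W (Suc r)) (\<lambda>r. e (Suc r)) k \<frown> z)"
          unfolding power_concat_shift conc_conc[symmetric] using xu by (simp only:)
        then show ?thesis by (metis same_concat_eq)
      qed
    qed
    then show ?thesis using xu by blast
  qed
next
  assume "\<exists>y. x = ?u \<frown> y \<and> ?P y"
  then obtain y where y: "x = ?u \<frown> y" "?P y" by blast
  from y(2) consider
    k where "e (Suc k) = \<infinity>" "\<forall>r<k. e (Suc r) \<noteq> \<infinity>"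
      "y = power_concat (\<lambda>r. W (Suc r)) (\<lambda>r. e (Suc r)) k \<frown> (W (Suc k))\<^sup>\<omega>"
  | "\<forall>r. e (Suc r) \<noteq> \<infinity>" "\<forall>N. \<exists>k. N < length (power_concat (\<lambda>r. W (Suc r)) (\<lambda>r. e (Suc r)) k)"
    "\<forall>k. \<exists>z. y = power_concat (\<lambda>r. W (Suc r)) (\<lambda>r. e (Suc r)) k \<frown> z"
    unfolding is_power_product_def by blast
  then show ?L
  proof cases
    case 1
    show ?thesis
      unfolding is_power_product_def
      by (intro disjI1 exI[of _ "Suc k"])
        (use 1 assms y(1) in \<open>auto simp: power_concat_shift less_Suc_eq_0_disj\<close>)
  next
    case 2
    have fin: "e r \<noteq> \<infinity>" for r using 2(1) assms by (cases r) auto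
    have len: "\<exists>k. N < length (power_concat W e k)" for N
    proof -
      obtain k where "N < length (power_concat (\<lambda>r. W (Suc r)) (\<lambda>r. e (Suc r)) k)" using 2(2) by blast
      then show ?thesis by (intro exI[of _ "Suc k"]) (simp add: power_concat_shift)
    qed
    have pre: "\<exists>z. x = power_concat W e k \<frown> z" for k
    proof (cases k)
      case (Suc k')
      obtain z where "y = power_concat (\<lambda>r. W (Suc r)) (\<lambda>r. e (Suc r)) k' \<frown> z" using 2(3) by blast
      then show ?thesis using y(1) by (auto simp: Suc power_concat_shift)
    qed simp
    show ?thesis unfolding is_power_product_def using fin len pre by blast
  qed
qed

lemma is_power_product_zero:
  assumes "e 0 = 0"
  shows "is_power_product W e x \<longleftrightarrow> is_power_product (\<lambda>r. W (Suc r)) (\<lambda>r. e (Suc r)) x"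
  using is_power_product_finite[of e W x] assms by (simp add: zero_enat_def)

text \<open>Infinite length excludes the empty product; the position of a nonzero exponent is what
  the peeling induction below descends on.\<close>

lemma is_power_product_nonzero:
  assumes "is_power_product W e x" shows "\<exists>r. e r \<noteq> 0"
proof (rule ccontr)
  assume "\<not> ?thesis"
  then have z: "e r = 0" for r by blast
  have "power_concat W e k = []" for k by (induction k) (simp_all add: power_concat_Suc z zero_enat_def)
  then show False using assms unfolding is_power_product_def by (auto simp: z)
qed

lemma nth_concat_replicate:
  "p < j * length w \<Longrightarrow> concat (replicate j w) ! p = w ! (p mod length w)"
proof (induction j arbitrary: p)
  case (Suc j)
  then show ?case by (cases "p < length w") (auto simp: nth_append le_mod_geq)
qed simp

lemma length_concat_replicate: "length (concat (replicate j w)) = j * length w"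
  by (induction j) auto

lemma concat_replicate_Suc_right: "concat (replicate (Suc j) w) = concat (replicate j w) @ w"
  by (induction j) auto

section \<open>The sequences between \<open>a\<^sup>\<omega>\<close> and \<open>\<tau>\<close>\<close>

context admissible_word
begin

text \<open>The bounds hold at every shift, whatever digit precedes it, so the set is closed under
  shifts and reflection; \<open>violation_tails\<close> shows that the sequences behind a violation
  belong to it.\<close>

definition tails :: "nat word set" where
  "tails = {y \<in> digit_seqs m. \<forall>k. less_fun (suffix k y) \<tau> \<and> less_fun (reflect_seq m (suffix k y)) \<tau>}"

definition starts :: "nat \<Rightarrow> nat word \<Rightarrow> bool" where
  "starts l y \<longleftrightarrow> (\<forall>j<N l. y j = \<tau> j)"

abbreviation "c \<equiv> cword m a"
abbreviation "r l \<equiv> reflect m (cword m a l)"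

lemma length_r [simp]: "length (r l) = N l" by (simp add: reflect_def)

lemma r_nth: "j < N l \<Longrightarrow> r l ! j = m - \<tau> j" by (simp add: reflect_def cword_nth)

lemma tails_suffix: "y \<in> tails \<Longrightarrow> suffix k y \<in> tails"
  unfolding tails_def by (auto simp del: suffix_nth)

lemma tails_reflect_seq: "y \<in> tails \<Longrightarrow> reflect_seq m y \<in> tails"
  unfolding tails_def by auto

lemma tails_digits: "y \<in> tails \<Longrightarrow> y \<in> digit_seqs m" by (simp add: tails_def)

lemma tails_less: "y \<in> tails \<Longrightarrow> less_fun y \<tau>"
  unfolding tails_def by (metis (mono_tags, lifting) mem_Collect_eq suffix_0)

lemma starts_conc: "starts l y \<Longrightarrow> y = c l \<frown> suffix (N l) y"
  by (auto simp: starts_def conc_def cword_nth fun_eq_iff)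

lemma starts_mono: "l \<le> l' \<Longrightarrow> starts l' y \<Longrightarrow> starts l y"
  using N_mono unfolding starts_def by (meson order_less_le_trans)

lemma starts_all: "(\<And>l. starts l y) \<Longrightarrow> y = \<tau>"
  using less_N unfolding starts_def by blast

text \<open>Take the longest block at the start of \<open>y\<close>. Being below \<tau>, and having
  reflected shifts below \<tau>, leaves for the next letters only the reflected block or its
  successor; the successor would give a longer block.\<close>

lemma block_step:
  assumes y: "y \<in> tails" "starts i y"
  obtains f where "i \<le> f" "starts f y" "starts f (reflect_seq m (suffix (N f) y))"
proof -
  have "y \<noteq> \<tau>" using tails_less[OF y(1)] less_fun_irrefl by blast
  then obtain p where p: "y p \<noteq> \<tau> p" by auto
  \<comment> \<open>A disagreement with \<tau> at \<open>p\<close> bounds the blocks, since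
    \<open>f < N f \<le> p\<close>; hence a longest one exists.\<close>
  have bound: "\<forall>f. starts f y \<longrightarrow> f \<le> p"
  proof (intro allI impI)
    fix f assume "starts f y"
    then have "N f \<le> p" using p unfolding starts_def by (meson not_le)
    then show "f \<le> p" using less_N[of f] by simp
  qed
  define f where "f = (GREATEST f. starts f y)"
  have f: "starts f y" unfolding f_def by (rule GreatestI_nat[where k = i]) (use y(2) bound in blast)+
  have i: "i \<le> f" unfolding f_def by (rule Greatest_le_nat[where b = p]) (use y(2) bound in blast)+
  have "\<not> starts (Suc f) y"
    using Greatest_le_nat[of "\<lambda>f. starts f y" "Suc f" p] bound unfolding f_def[symmetric] by auto
  then obtain p' where p': "p' < N (Suc f)" "y p' \<noteq> \<tau> p'" unfolding starts_def by blast
  have "N f \<le> p'" using p'(2) f unfolding starts_def by (metis not_le)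
  then have nS: "p' - N f < N f" "y (N f + (p' - N f)) \<noteq> \<tau> (N f + (p' - N f))"
    using p' by (auto simp: N_Suc)
  let ?x = "suffix (N f) y"
  have d: "?x j \<le> m" "\<tau> j \<le> m" for j
    using digit_seqsD[OF tails_digits[OF y(1)]] digit_seqsD[OF \<tau>_digits] by auto
  have "less_fun ?x (suffix (N f) \<tau>)"
    by (subst less_fun_suffix_iff) (use f tails_less[OF y(1)] in \<open>auto simp: starts_def\<close>)
  then have A: "\<not> less_fun (suffix (N f) \<tau>) ?x" by (rule less_fun_asym)
  have B: "\<not> less_fun \<tau> (reflect_seq m ?x)"
    using y(1) less_fun_asym unfolding tails_def by blast
  have "?x j = m - \<tau> j" if "j < N f" for j
  proof (rule ccontr)
    assume "?x j \<noteq> m - \<tau> j"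
    \<comment> \<open>The first departure from the reflected block. The letter there lies above the
      reflected letter and at most at the corresponding letter of the next block; these differ only
      at the last position, so a departure would complete \<open>c (Suc f)\<close>.\<close>
    define p where "p = (LEAST j. ?x j \<noteq> m - \<tau> j)"
    have p: "?x p \<noteq> m - \<tau> p" unfolding p_def by (rule LeastI[where k = j]) fact
    have pj: "p \<le> j" unfolding p_def by (rule Least_le) fact
    have lt: "?x i = m - \<tau> i" if "i < p" for i using not_less_Least that unfolding p_def by blast
    have "\<not> ?x p < m - \<tau> p"
    proof
      assume "?x p < m - \<tau> p"
      then have "\<tau> p < reflect_seq m ?x p \<and> (\<forall>i<p. \<tau> i = reflect_seq m ?x i)"
        using lt d by (auto simp: reflect_seq_def simp del: suffix_nth)
      then show False using B unfolding less_fun_def by blast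
    qed
    then have gt: "m - \<tau> p < ?x p" using p by simp
    have le: "?x p \<le> suffix (N f) \<tau> p"
    proof (rule ccontr)
      assume "\<not> ?x p \<le> suffix (N f) \<tau> p"
      moreover have "\<forall>i<p. suffix (N f) \<tau> i = ?x i"
        using lt \<tau>_step[of _ f] pj that by auto
      ultimately show False using A unfolding less_fun_def by (meson not_le)
    qed
    then have "Suc p = N f" using gt \<tau>_step[of p f] pj that by (auto split: if_splits)
    then have "?x p = suffix (N f) \<tau> p" using le gt \<tau>_step[of p f] by auto
    then have "\<forall>i<N f. ?x i = suffix (N f) \<tau> i"
      using lt \<tau>_step[of _ f] \<open>Suc p = N f\<close> by (metis less_antisym suffix_nth not_less_eq)
    then show False using nS by auto
  qed
  then have "starts f (reflect_seq m ?x)"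
    using d by (auto simp: starts_def reflect_seq_def simp del: suffix_nth)
  then show ?thesis using that i f by blast
qed

lemma starts_reflect_conc:
  assumes "y \<in> digit_seqs m" "starts l (reflect_seq m y)"
  shows "y = r l \<frown> suffix (N l) y"
proof
  fix j
  have "m - y j = \<tau> j" if "j < N l" using assms(2) that by (simp add: starts_def reflect_seq_def)
  then show "y j = (r l \<frown> suffix (N l) y) j"
    using digit_seqsD[OF assms(1), of j] by (auto simp: conc_def r_nth)
qed

text \<open>Two block steps, the second on the reflected remainder, which begins with
  \<open>c f\<close>; therefore \<open>f \<le> g\<close>. What is left begins with
  \<open>c g\<close>, so the step can be repeated.\<close>

lemma tails_peel:
  assumes y: "y \<in> tails" "starts i y"
  obtains f g y' where "i \<le> f" "f \<le> g" "y = (c f @ r g) \<frown> y'" "y' \<in> tails" "starts f y" "starts g y'"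
proof -
  obtain f where f: "i \<le> f" "starts f y" "starts f (reflect_seq m (suffix (N f) y))"
    using block_step[OF y] .
  let ?z = "reflect_seq m (suffix (N f) y)"
  have z: "?z \<in> tails" using y tails_suffix tails_reflect_seq by blast
  obtain g where g: "f \<le> g" "starts g ?z" "starts g (reflect_seq m (suffix (N g) ?z))"
    using block_step[OF z f(3)] .
  let ?y' = "suffix (N f + N g) y"
  have "reflect_seq m (suffix (N g) ?z) = ?y'"
    using tails_digits[OF y(1)] by simp
  moreover have "suffix (N f) y = r g \<frown> suffix (N g) (suffix (N f) y)"
    by (rule starts_reflect_conc) (use tails_digits[OF y(1)] g(2) in auto)
  then have "y = (c f @ r g) \<frown> ?y'"
    using starts_conc[OF f(2)] by (metis conc_conc suffix_suffix)
  ultimately show ?thesis using that f g tails_suffix[OF y(1)] by metis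
qed

text \<open>Positions are counted from behind the factor with exponent \<open>j\<close>, so that
  removing two factors amounts to shifting \<open>ii\<close>, \<open>jj\<close> and
  \<open>ll\<close>.\<close>

definition factor :: "(nat \<Rightarrow> nat) \<Rightarrow> nat \<Rightarrow> nat list" where
  "factor ii k = factor_word m a ii (Suc k)"

definition exponent :: "(nat \<Rightarrow> enat) \<Rightarrow> (nat \<Rightarrow> nat) \<Rightarrow> nat \<Rightarrow> enat" where
  "exponent jj ll k = factor_exponent 0 jj ll (Suc k)"

lemma factor_even: "factor ii (2 * t) = c (ii t) @ r (ii t)"
  by (simp add: factor_def factor_word_def)

lemma factor_odd: "factor ii (Suc (2 * t)) = c (ii t) @ r (ii (Suc t))"
  by (simp add: factor_def factor_word_def)

lemma exponent_even: "exponent jj ll (2 * t) = jj t"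
  by (simp add: exponent_def factor_exponent_def)

lemma exponent_odd: "exponent jj ll (Suc (2 * t)) = enat (ll t)"
  by (simp add: exponent_def factor_exponent_def)

lemma factor_shift: "(\<lambda>k. factor ii (Suc (Suc k))) = factor (\<lambda>t. ii (Suc t))"
  by (simp add: fun_eq_iff factor_def factor_word_def Let_def)

lemma exponent_shift: "(\<lambda>k. exponent jj ll (Suc (Suc k))) = exponent (\<lambda>t. jj (Suc t)) (\<lambda>t. ll (Suc t))"
  by (simp add: fun_eq_iff exponent_def factor_exponent_def Let_def)

definition tail_form :: "nat \<Rightarrow> nat word \<Rightarrow> bool" where
  "tail_form e y \<longleftrightarrow> (\<exists>ii jj ll. strict_mono ii \<and> e \<le> ii 0 \<and> (\<forall>t. ll t \<le> 1) \<and>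
     is_power_product (factor ii) (exponent jj ll) y)"

text \<open>\<open>s\<close> is the position of some nonzero exponent. Dropping a pair of zero
  exponents lowers it by two, so an actual factor is reached. An infinite first exponent gives back
  the same sequence, a positive finite one is lowered by one.\<close>

lemma tail_form_peel_aux:
  assumes "strict_mono ii" "e \<le> ii 0" "\<forall>t. ll t \<le> 1"
    "is_power_product (factor ii) (exponent jj ll) y" "exponent jj ll s \<noteq> 0"
  shows "\<exists>f g y'. e \<le> f \<and> f \<le> g \<and> y = (c f @ r g) \<frown> y' \<and> tail_form g y'"
  using assms
proof (induction s arbitrary: ii jj ll y e rule: less_induct)
  case (less s)
  note ii = less.prems(1,2) and ll = less.prems(3) and PP = less.prems(4) and nz = less.prems(5)
  have f0: "factor ii 0 = c (ii 0) @ r (ii 0)" and e0: "exponent jj ll 0 = jj 0"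
    and f1: "factor ii (Suc 0) = c (ii 0) @ r (ii 1)" and e1: "exponent jj ll (Suc 0) = enat (ll 0)"
    using factor_even[of ii 0] exponent_even[of jj ll 0] factor_odd[of ii 0] exponent_odd[of jj ll 0] by auto
  have ii': "strict_mono (\<lambda>t. ii (Suc t))" "ii 0 < ii 1"
    using ii(1) by (auto simp: strict_mono_def)
  show ?case
  proof (cases "jj 0")
    case infinity
    then have y: "y = (c (ii 0) @ r (ii 0))\<^sup>\<omega>"
      using PP is_power_product_infinity[of "exponent jj ll" "factor ii" y] e0 f0 by simp
    then have "y = (c (ii 0) @ r (ii 0)) \<frown> y"
      using iter_unroll[of "c (ii 0) @ r (ii 0)"] N_pos[of "ii 0"] by simp
    moreover have "tail_form (ii 0) y" unfolding tail_form_def using ii(1) ll PP by blast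
    ultimately show ?thesis using ii(2) by blast
  next
    case (enat d)
    show ?thesis
    proof (cases d)
      case (Suc d')
      define jj' where "jj' = jj(0 := enat d')"
      have e0': "exponent jj' ll 0 = enat d'"
        using exponent_even[of jj' ll 0] by (simp add: jj'_def)
      have eS: "(\<lambda>k. exponent jj' ll (Suc k)) = (\<lambda>k. exponent jj ll (Suc k))"
        by (rule ext) (auto simp: exponent_def factor_exponent_def jj'_def Let_def)
      obtain z where z: "y = concat (replicate (Suc d') (factor ii 0)) \<frown> z"
        "is_power_product (\<lambda>k. factor ii (Suc k)) (\<lambda>k. exponent jj ll (Suc k)) z"
        using PP is_power_product_finite[of "exponent jj ll" "factor ii" y] e0 enat Suc by auto
      have "is_power_product (factor ii) (exponent jj' ll) (concat (replicate d' (factor ii 0)) \<frown> z)"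
        by (subst is_power_product_finite) (use z(2) e0' eS in auto)
      then have "tail_form (ii 0) (concat (replicate d' (factor ii 0)) \<frown> z)"
        unfolding tail_form_def using ii(1) ll by blast
      moreover have "y = (c (ii 0) @ r (ii 0)) \<frown> (concat (replicate d' (factor ii 0)) \<frown> z)"
        using z(1) f0 by simp
      ultimately show ?thesis using ii(2) by blast
    next
      case 0
      then have P1: "is_power_product (\<lambda>k. factor ii (Suc k)) (\<lambda>k. exponent jj ll (Suc k)) y"
        using PP is_power_product_zero[of "exponent jj ll" "factor ii" y] e0 enat by (simp add: zero_enat_def)
      have "ll 0 = 0 \<or> ll 0 = 1" using ll by (metis le_SucE le_zero_eq One_nat_def)
      then show ?thesis
      proof
        assume l0: "ll 0 = 0"
        have P2: "is_power_product (factor (\<lambda>t. ii (Suc t))) (exponent (\<lambda>t. jj (Suc t)) (\<lambda>t. ll (Suc t))) y"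
          using P1 is_power_product_zero[of "\<lambda>k. exponent jj ll (Suc k)" "\<lambda>k. factor ii (Suc k)" y] e1 l0
          by (simp add: zero_enat_def factor_shift exponent_shift)
        have "s \<noteq> 0" "s \<noteq> 1" using nz e0 e1 l0 enat 0 by (auto simp: zero_enat_def intro!: gr0I)
        then obtain s' where s: "s = Suc (Suc s')" by (metis One_nat_def not0_implies_Suc)
        have "exponent (\<lambda>t. jj (Suc t)) (\<lambda>t. ll (Suc t)) s' \<noteq> 0"
          using nz exponent_shift[of jj ll] unfolding s by metis
        then show ?thesis
          using less.IH[of s' "\<lambda>t. ii (Suc t)" e "\<lambda>t. ll (Suc t)"] ii ii' ll P2 s by fastforce
      next
        assume l1: "ll 0 = 1"
        obtain z where z: "y = (c (ii 0) @ r (ii 1)) \<frown> z"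
          "is_power_product (factor (\<lambda>t. ii (Suc t))) (exponent (\<lambda>t. jj (Suc t)) (\<lambda>t. ll (Suc t))) z"
          using P1 is_power_product_finite[of "\<lambda>k. exponent jj ll (Suc k)" "\<lambda>k. factor ii (Suc k)" y] e1 l1 f1
          by (auto simp: factor_shift exponent_shift)
        have "tail_form (ii 1) z"
          unfolding tail_form_def
          by (rule exI[of _ "\<lambda>t. ii (Suc t)"], rule exI[of _ "\<lambda>t. jj (Suc t)"], rule exI[of _ "\<lambda>t. ll (Suc t)"])
            (use z(2) ii' ll in auto)
        then show ?thesis using z(1) ii(2) ii'(2) less_imp_le by blast
      qed
    qed
  qed
qed

lemma tail_form_peel:
  assumes "tail_form e y"
  obtains f g y' where "e \<le> f" "f \<le> g" "y = (c f @ r g) \<frown> y'" "tail_form g y'"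
  using assms is_power_product_nonzero tail_form_peel_aux unfolding tail_form_def by metis

lemma conc_starts: "e \<le> f \<Longrightarrow> starts e ((c f @ r g) \<frown> y)"
  using N_mono[of e f] by (auto simp: starts_def nth_append cword_nth)

lemma tail_form_starts: "tail_form e y \<Longrightarrow> starts e y"
  using tail_form_peel conc_starts by metis

text \<open>Each peeled pair has positive length, which allows strong induction on the position in
  place of coinduction.\<close>

lemma tail_form_digits:
  assumes "tail_form e y" shows "y \<in> digit_seqs m"
proof -
  have "tail_form e y \<longrightarrow> y k \<le> m" for k
  proof (induction k arbitrary: e y rule: less_induct)
    case (less k)
    show ?case
    proof
      assume "tail_form e y"
      then obtain f g y' where y: "y = (c f @ r g) \<frown> y'" "tail_form g y'" by (rule tail_form_peel)
      show "y k \<le> m"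
      proof (cases "k < N f + N g")
        case True
        then show ?thesis
          using digit_seqsD[OF \<tau>_digits, of k] by (auto simp: y(1) nth_append cword_nth r_nth)
      next
        case False
        then show ?thesis
          using less.IH[of "k - (N f + N g)" g y'] y N_pos[of f] by auto
      qed
    qed
  qed
  then show ?thesis using assms by (simp add: digit_seqs_def)
qed

text \<open>Strong induction on the shift. Inside \<open>c f\<close> the following letters are those
  of \<open>r f\<close>, a prefix of \<open>r g\<close> as \<open>f \<le> g\<close>; inside
  \<open>r g\<close> the same holds after reflection; beyond the pair the induction hypothesis
  applies.\<close>

lemma tail_form_tails:
  assumes "tail_form e y" shows "y \<in> tails"
proof -
  have "tail_form e y \<longrightarrow> less_fun (suffix k y) \<tau> \<and> less_fun (reflect_seq m (suffix k y)) \<tau>" for k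
  proof (induction k arbitrary: e y rule: less_induct)
    case (less k)
    show ?case
    proof
      assume tf: "tail_form e y"
      then obtain f g y' where fg: "f \<le> g" and y: "y = (c f @ r g) \<frown> y'" "tail_form g y'"
        by (rule tail_form_peel)
      have dig: "y \<in> digit_seqs m" using tf by (rule tail_form_digits)
      have st: "starts g y'" using y(2) by (rule tail_form_starts)
      have y1: "\<forall>j<N f. y j = \<tau> j" by (simp add: y(1) nth_append cword_nth)
      have y2: "\<forall>j<N g. y (N f + j) = m - \<tau> j" by (simp add: y(1) nth_append r_nth)
      have y3: "suffix (N f + N g) y = y'" by (simp add: y(1) fun_eq_iff)
      consider "k < N f" | "N f \<le> k" "k < N f + N g" | "N f + N g \<le> k" by linarith
      then show "less_fun (suffix k y) \<tau> \<and> less_fun (reflect_seq m (suffix k y)) \<tau>"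
      proof cases
        case 1
        have "\<forall>j<N f. y (N f + j) = m - \<tau> j" using y2 N_mono[OF fg] by auto
        then show ?thesis using block_suffix_less'[OF y1 _ 1] by blast
      next
        case 2
        \<comment> \<open>The reflected rest is \<open>c g\<close> followed by \<open>r g\<close>,
          because \<open>y'\<close> begins with \<open>c g\<close>.\<close>
        define z where "z = reflect_seq m (suffix (N f) y)"
        have z1: "\<forall>j<N g. z j = \<tau> j"
          using y2 digit_seqsD[OF \<tau>_digits] by (simp add: z_def reflect_seq_def)
        have z2: "\<forall>j<N g. z (N g + j) = m - \<tau> j"
        proof (intro allI impI)
          fix j assume "j < N g"
          then have "suffix (N f + N g) y j = \<tau> j" unfolding y3 using st by (simp add: starts_def)
          then show "z (N g + j) = m - \<tau> j" by (simp add: z_def reflect_seq_def add.assoc)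
        qed
        have k: "k - N f < N g" using 2 by simp
        have "suffix (k - N f) z = reflect_seq m (suffix k y)" using 2 by (simp add: z_def)
        then show ?thesis
          using block_suffix_less'[OF z1 z2 k] dig by simp
      next
        case 3
        have "suffix (k - (N f + N g)) y' = suffix k y" unfolding y3[symmetric] using 3 by simp
        moreover have "less_fun (suffix (k - (N f + N g)) y') \<tau> \<and>
            less_fun (reflect_seq m (suffix (k - (N f + N g)) y')) \<tau>"
          by (rule less.IH[rule_format, OF _ y(2)]) (use 3 N_pos[of f] in auto)
        ultimately show ?thesis by (simp only:)
      qed
    qed
  qed
  then show ?thesis using assms tail_form_digits unfolding tails_def by blast
qed

text \<open>Split off as many copies of \<open>c i @ r i\<close> as possible. If their number is
  unbounded, the sequence is periodic; otherwise the next pair either starts with \<open>c i\<close>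
  and goes to a larger index (\<open>l = 1\<close>), or already starts with a larger block
  (\<open>l = 0\<close>).\<close>

lemma tails_step:
  assumes y: "y \<in> tails" "starts i y"
  shows "y = (c i @ r i)\<^sup>\<omega> \<or> (\<exists>j l i' y'. i < i' \<and> l \<le> (1::nat) \<and> y' \<in> tails \<and> starts i' y' \<and>
    y = (concat (replicate j (c i @ r i)) @ concat (replicate l (c i @ r i'))) \<frown> y')"
proof -
  let ?w = "c i @ r i"
  define Q where "Q j \<longleftrightarrow> (\<exists>y'. y = concat (replicate j ?w) \<frown> y' \<and> y' \<in> tails \<and> starts i y')" for j
  have Q0: "Q 0" using y by (auto simp: Q_def)
  show ?thesis
  proof (cases "\<forall>j. Q j")
    case True
    have "y p = (?w)\<^sup>\<omega> p" for p
    proof -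
      obtain y' where y': "y = concat (replicate (Suc p) ?w) \<frown> y'" using True Q_def by blast
      have "Suc p * 1 \<le> Suc p * length ?w" by (rule mult_le_mono2) (use N_pos[of i] in simp)
      then have "p < Suc p * length ?w" by (rule less_le_trans[rotated]) simp
      then have "y p = ?w ! (p mod length ?w)"
        unfolding y' using nth_concat_replicate[of p "Suc p" ?w]
        by (simp only: conc_fst length_concat_replicate)
      then show ?thesis using N_pos[of i] by (simp only: iter_nth length_append length_cword add_pos_pos length_r)
    qed
    then show ?thesis by blast
  next
    case False
    then obtain j where j: "Q j" "\<not> Q (Suc j)" using Q0 by (metis not0_implies_Suc nat_induct)
    then obtain z where z: "y = concat (replicate j ?w) \<frown> z" "z \<in> tails" "starts i z"
      unfolding Q_def by blast
    obtain f g z' where fg: "i \<le> f" "f \<le> g" "z = (c f @ r g) \<frown> z'" "z' \<in> tails" "starts f z" "starts g z'"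
      using tails_peel[OF z(2,3)] .
    show ?thesis
    proof (cases "f = i")
      case True
      have "g \<noteq> i"
      proof
        assume "g = i"
        then have "y = concat (replicate (Suc j) ?w) \<frown> z'"
          using z(1) fg(3) True by (simp only: concat_replicate_Suc_right conc_conc)
        then show False using j(2) fg(4,6) \<open>g = i\<close> unfolding Q_def by blast
      qed
      then have "i < g" using fg(1,2) by simp
      moreover have "y = (concat (replicate j ?w) @ concat (replicate 1 (c i @ r g))) \<frown> z'"
        using z(1) fg(3) True by simp
      ultimately show ?thesis using fg(4,6) le_refl by blast
    next
      case False
      then have "i < f" using fg(1) by simp
      moreover have "y = (concat (replicate j ?w) @ concat (replicate 0 (c i @ r f))) \<frown> z"
        using z(1) by simp
      ultimately show ?thesis using z(2) fg(5) by (metis zero_le)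
    qed
  qed
qed

text \<open>Iterates \<open>tails_step\<close> by choice and reads off indices and exponents. What
  remains is that the product exhausts \<open>y\<close>.\<close>

lemma tails_tail_form:
  assumes y: "y \<in> tails" "starts i y"
  shows "tail_form i y"
proof -
  define good where "good s \<longleftrightarrow> snd s \<in> tails \<and> starts (fst s) (snd s)" for s
  \<comment> \<open>A state is an index with a remaining sequence. The index grows even from states
    that are not \<open>good\<close>, which occur after an infinite exponent, because
    \<open>ii\<close> must increase strictly throughout.\<close>
  define step where "step s s' j l \<longleftrightarrow> fst s < fst s' \<and> l \<le> (1::nat) \<and>
    (good s \<longrightarrow> (j = \<infinity> \<and> snd s = (c (fst s) @ r (fst s))\<^sup>\<omega>) \<or>
      (j \<noteq> \<infinity> \<and> good s' \<and> snd s = (concat (replicate (the_enat j) (c (fst s) @ r (fst s))) @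
        concat (replicate l (c (fst s) @ r (fst s')))) \<frown> snd s'))" for s s' :: "nat \<times> nat word" and j l
  have ex: "\<exists>s' j l. step s s' j l" for s
  proof (cases "good s \<and> snd s \<noteq> (c (fst s) @ r (fst s))\<^sup>\<omega>")
    case True
    then obtain j l i' y' where "fst s < i'" "l \<le> (1::nat)" "y' \<in> tails" "starts i' y'"
      "snd s = (concat (replicate j (c (fst s) @ r (fst s))) @ concat (replicate l (c (fst s) @ r i'))) \<frown> y'"
      using tails_step[of "snd s" "fst s"] unfolding good_def by blast
    then have "step s (i', y') (enat j) l" by (simp add: step_def good_def)
    then show ?thesis by blast
  next
    case False
    then have "step s (Suc (fst s), y) \<infinity> 0" by (auto simp: step_def)
    then show ?thesis by blast
  qed
  define next_state where "next_state s = (SOME s'. \<exists>j l. step s s' j l)" for s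
  define S where "S t = (next_state ^^ t) (i, y)" for t
  have "\<exists>j l. step (S t) (S (Suc t)) j l" for t
    using someI_ex[OF ex[of "S t"]] by (simp add: S_def next_state_def)
  then obtain jj ll where st: "\<And>t. step (S t) (S (Suc t)) (jj t) (ll t)" by metis
  define ii where "ii t = fst (S t)" for t
  define Y where "Y t = snd (S t)" for t
  have S0: "ii 0 = i" "Y 0 = y" by (simp_all add: S_def ii_def Y_def)
  have mono: "strict_mono ii" using st by (auto simp: strict_mono_Suc_iff step_def ii_def)
  have ll: "\<forall>t. ll t \<le> 1" using st by (auto simp: step_def)
  let ?P = "power_concat (factor ii) (exponent jj ll)"
  have P2: "?P (2 * Suc t) = ?P (2 * t) @ concat (replicate (the_enat (jj t)) (c (ii t) @ r (ii t))) @
      concat (replicate (ll t) (c (ii t) @ r (ii (Suc t))))" for t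
    by (simp add: power_concat_Suc factor_even factor_odd exponent_even exponent_odd)
  have reach: "good (S t) \<and> y = ?P (2 * t) \<frown> Y t" if "\<forall>s<t. jj s \<noteq> \<infinity>" for t
    using that
  proof (induction t)
    case 0
    then show ?case using y S0 by (simp add: good_def Y_def ii_def)
  next
    case (Suc t)
    then have IH: "good (S t)" "y = ?P (2 * t) \<frown> Y t" and j: "jj t \<noteq> \<infinity>" by auto
    then have "good (S (Suc t))" "Y t = (concat (replicate (the_enat (jj t)) (c (ii t) @ r (ii t))) @
        concat (replicate (ll t) (c (ii t) @ r (ii (Suc t))))) \<frown> Y (Suc t)"
      using st[of t] by (auto simp: step_def Y_def ii_def)
    then show ?case using IH(2) by (metis P2 conc_conc append.assoc)
  qed
  have "is_power_product (factor ii) (exponent jj ll) y"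
  proof (cases "\<exists>t. jj t = \<infinity>")
    case True
    define t where "t = (LEAST t. jj t = \<infinity>)"
    have t: "jj t = \<infinity>" "\<forall>s<t. jj s \<noteq> \<infinity>"
      unfolding t_def using True not_less_Least by (auto intro: LeastI_ex)
    have "Y t = (c (ii t) @ r (ii t))\<^sup>\<omega>"
      using st[of t] reach[OF t(2)] t(1) by (simp add: step_def Y_def ii_def)
    moreover have "exponent jj ll k \<noteq> \<infinity>" if "k < 2 * t" for k
      by (cases k rule: parity_cases[case_names even odd])
        (use that t(2) in \<open>auto elim!: evenE oddE simp: exponent_even exponent_odd\<close>)
    ultimately show ?thesis
      unfolding is_power_product_def
      by (intro disjI1 exI[of _ "2 * t"]) (use t reach[OF t(2)] in \<open>auto simp: exponent_even factor_even\<close>)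
  next
    case False
    then have R: "good (S t)" "y = ?P (2 * t) \<frown> Y t" for t using reach by auto
    have fin: "exponent jj ll k \<noteq> \<infinity>" for k
      by (cases "even k") (use False in \<open>auto elim!: evenE oddE simp: exponent_even exponent_odd\<close>)
    have pre: "\<exists>z. y = ?P k \<frown> z" for k
    proof -
      obtain u where "?P (2 * k) = ?P k @ u" using power_concat_prefix[of k "2 * k"] by auto
      then have "y = ?P k \<frown> (u \<frown> Y k)" using R(2)[of k] by simp
      then show ?thesis by blast
    qed
    \<comment> \<open>With bounded lengths the remainders would become one constant sequence that
      begins with every \<open>c l\<close>. This is \<tau>, which is not strictly below
      itself.\<close>
    have len: "\<exists>k. L < length (?P k)" for L
    proof (rule ccontr)
      assume "\<not> ?thesis"
      then have b: "\<forall>z. (\<exists>t. z = length (?P (2 * t))) \<longrightarrow> z \<le> L" by (auto simp: not_less)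
      define G where "G = (GREATEST z. \<exists>t. z = length (?P (2 * t)))"
      have "\<exists>t. G = length (?P (2 * t))"
        unfolding G_def by (rule GreatestI_nat[where k = "length (?P (2 * 0))"]) (use b in blast)+
      then obtain t where t: "G = length (?P (2 * t))" by blast
      have same: "Y s = Y t" if ts: "t \<le> s" for s
      proof -
        obtain u where u: "?P (2 * s) = ?P (2 * t) @ u"
          using power_concat_prefix[of "2 * t" "2 * s"] ts by auto
        have "length (?P (2 * s)) \<le> G"
          unfolding G_def by (rule Greatest_le_nat[where b = L]) (use b in blast)+
        then have "u = []" using u t by simp
        then show ?thesis using R(2)[of s] R(2)[of t] u by (metis append_Nil2 same_concat_eq)
      qed
      have "starts l (Y t)" for l
      proof -
        have "l \<le> ii (max l t)" using strict_mono_imp_increasing[OF mono, of "max l t"] by simp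
        moreover have "starts (ii (max l t)) (Y t)"
          using R(1)[of "max l t"] same[of "max l t"] by (simp add: good_def ii_def Y_def)
        ultimately show ?thesis by (rule starts_mono)
      qed
      then have "Y t = \<tau>" by (rule starts_all)
      then show False
        using R(1)[of t] tails_less[of "Y t"] less_fun_irrefl by (auto simp: good_def Y_def)
    qed
    show ?thesis unfolding is_power_product_def using fin pre len by blast
  qed
  then show ?thesis unfolding tail_form_def using mono ll S0 by blast
qed

end

section \<open>Matched words\<close>

abbreviation prefix_le :: "nat \<Rightarrow> nat word \<Rightarrow> nat word \<Rightarrow> bool" where
  "prefix_le L x y \<equiv> prefix_less L x y \<or> prefix_eq L x y"

lemma prefix_le_cong:
  assumes "prefix_eq L x x'" "prefix_eq L y y'"
  shows "prefix_le L x y \<longleftrightarrow> prefix_le L x' y'"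
proof -
  have s: "prefix_eq L x' x" "prefix_eq L y' y" using assms by (auto simp: prefix_eq_def)
  have "prefix_eq L x y \<longleftrightarrow> prefix_eq L x' y'" using assms by (auto simp: prefix_eq_def)
  then show ?thesis using prefix_less_cong assms s by blast
qed

lemma prefix_le_reflect_seq:
  assumes "x \<in> digit_seqs m" "y \<in> digit_seqs m"
  shows "prefix_le L (reflect_seq m x) y \<longleftrightarrow> prefix_le L (reflect_seq m y) x"
proof -
  have d: "x i \<le> m" "y i \<le> m" for i using assms by (auto simp: digit_seqs_def)
  have e: "(m - x k < y k) = (m - y k < x k)" "(m - x k = y k) = (m - y k = x k)" for k
    using d[of k] by auto
  then show ?thesis by (simp add: prefix_less_def prefix_eq_def reflect_seq_def)
qed

context admissible_word
begin

lemma \<alpha>_suffix_mod: "suffix k \<alpha> = suffix (k mod n) \<alpha>"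
  using n_pos by (simp add: fun_eq_iff mod_add_left_eq)

lemma \<alpha>_suffix_le: "\<not> less_fun \<alpha> (suffix k \<alpha>)"
proof (cases "k mod n = 0")
  case True
  then show ?thesis using \<alpha>_suffix_mod[of k] less_fun_irrefl[of \<alpha>] by simp
next
  case False
  then have "less_fun (suffix (k mod n) \<alpha>) \<alpha>" using suffix_less[of "k mod n"] n_pos by simp
  then show ?thesis using \<alpha>_suffix_mod[of k] less_fun_asym by metis
qed

lemma \<alpha>_less_fun_\<tau>: "less_fun \<alpha> \<tau>"
  using \<alpha>_less_\<tau> by (rule prefix_less_imp_less_fun)

lemma \<alpha>_tails: "\<alpha> \<in> tails"
proof -
  have "less_fun (suffix k \<alpha>) \<tau>" for k
    using \<alpha>_suffix_le \<alpha>_less_fun_\<tau> not_less_fun_less_fun_trans by blast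
  moreover have "less_fun (reflect_seq m (suffix k \<alpha>)) \<tau>" for k
    using reflect_suffix_less \<alpha>_less_fun_\<tau> less_fun_trans by blast
  ultimately show ?thesis using digits unfolding tails_def by blast
qed

lemma starts_0_base: "starts 0 y \<Longrightarrow> Suc j < n \<Longrightarrow> y j = \<alpha> j"
  by (simp add: starts_def N_0 \<tau>_base)

lemma starts_0_greater: "starts 0 y \<Longrightarrow> less_fun \<alpha> y"
  unfolding less_fun_def starts_def
  by (rule exI[of _ "n - 1"]) (use n_pos in \<open>auto simp: N_0 \<tau>_base simp del: iter_nth\<close>)

lemma has_form_iff:
  "has_form m a b \<longleftrightarrow> (\<exists>w x. matched m a w \<and> b = w \<frown> x \<and> (x = \<alpha> \<or> tail_form 0 x))"
proof -
  have P0: "is_power_product (factor_word m a ii) (factor_exponent 0 jj ll) x \<longleftrightarrow>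
      is_power_product (factor ii) (exponent jj ll) x" for ii jj ll x
    using is_power_product_zero[of "factor_exponent 0 jj ll" "factor_word m a ii" x]
    unfolding factor_def exponent_def by (simp add: factor_exponent_def)
  have Pinf: "is_power_product (factor_word m a ii) (factor_exponent \<infinity> jj ll) x \<longleftrightarrow> x = \<alpha>" for ii jj ll x
    using is_power_product_infinity[of "factor_exponent \<infinity> jj ll" "factor_word m a ii" x]
    by (simp add: factor_exponent_def factor_word_def)
  show ?thesis
  proof
    assume "has_form m a b"
    then obtain w ii j jj ll x where *: "matched m a w" "strict_mono ii" "j \<in> {0, \<infinity>}" "\<forall>t. ll t \<le> 1"
      "is_power_product (factor_word m a ii) (factor_exponent j jj ll) x" "b = w \<frown> x"
      unfolding has_form_def by blast
    have "x = \<alpha> \<or> tail_form 0 x"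
      using *(2-5) P0 Pinf unfolding tail_form_def by blast
    then show "\<exists>w x. matched m a w \<and> b = w \<frown> x \<and> (x = \<alpha> \<or> tail_form 0 x)" using * by blast
  next
    assume "\<exists>w x. matched m a w \<and> b = w \<frown> x \<and> (x = \<alpha> \<or> tail_form 0 x)"
    then obtain w x where *: "matched m a w" "b = w \<frown> x" "x = \<alpha> \<or> tail_form 0 x" by blast
    from *(3) show "has_form m a b"
    proof
      assume "x = \<alpha>"
      then have "is_power_product (factor_word m a id) (factor_exponent \<infinity> (\<lambda>_. 0) (\<lambda>_. 0)) x"
        using Pinf by blast
      then show ?thesis
        unfolding has_form_def using *(1,2)
        by (intro exI[of _ w] exI[of _ id] exI[of _ \<infinity>] exI[of _ "\<lambda>_. 0"] exI[of _ x])
          (auto simp: strict_mono_def)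
    next
      assume "tail_form 0 x"
      then show ?thesis unfolding has_form_def tail_form_def using P0 *(1,2) by blast
    qed
  qed
qed

text \<open>Windows of \<open>n\<close> letters that start inside \<open>w\<close> read at most
  \<open>n - 1\<close> letters behind it. So \<open>a\<close> may be replaced by \<alpha> or by a
  sequence that begins with \<open>c 0\<close>, which differs from \<open>a\<close> only in the last
  letter.\<close>

lemma matched_iff:
  assumes x: "\<And>j. Suc j < n \<Longrightarrow> x j = \<alpha> j" "x \<in> digit_seqs m"
  shows "matched m a w \<longleftrightarrow> w \<noteq> [] \<and> set w \<subseteq> {0..m} \<and> last w < m \<and>
    (\<forall>l. 0 < l \<longrightarrow> l < length w \<longrightarrow>
      (take l w \<noteq> replicate l m \<longrightarrow> prefix_le n (suffix l (w \<frown> x)) \<alpha>) \<and>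
      (take l w \<noteq> replicate l 0 \<longrightarrow> prefix_le n (reflect_seq m (suffix l (w \<frown> x))) \<alpha>))"
proof (cases "w \<noteq> [] \<and> set w \<subseteq> {0..m}")
  case True
  have dig: "w \<frown> x \<in> digit_seqs m"
    unfolding digit_seqs_def
  proof (intro CollectI allI)
    fix i show "(w \<frown> x) i \<le> m"
      using True digit_seqsD[OF x(2)] nth_mem[of i w] by (auto simp: conc_def simp del: nth_mem)
  qed
  let ?v = "\<lambda>l. take n (drop l (w @ a))"
  have len: "length (?v l) = n" if "l \<le> length w" for l using that by simp
  have aeq: "prefix_eq n ((!) a) \<alpha>" using n_pos by (simp add: prefix_eq_def)
  have req: "prefix_eq n ((!) (reflect m a)) (reflect_seq m \<alpha>)"
    using n_pos by (simp add: prefix_eq_def reflect_def reflect_seq_def)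
  have rlen: "length (reflect m a) = n" by (simp add: reflect_def)
  have veq: "prefix_eq n ((!) (?v l)) (suffix l (w \<frown> x))" if "l < length w" for l
    unfolding prefix_eq_def
  proof (intro allI impI)
    fix j assume j: "j < n"
    have "(w @ a) ! (l + j) = (w \<frown> x) (l + j)"
    proof (cases "l + j < length w")
      case False
      then have s: "Suc (l + j - length w) < n" using j that by auto
      then show ?thesis using False x(1)[OF s] n_pos by (simp add: nth_append)
    qed (simp add: nth_append)
    moreover have "l \<le> length (w @ a)" using that by simp
    ultimately show "?v l ! j = suffix l (w \<frown> x) j" using j by (simp only: nth_take nth_drop suffix_nth)
  qed
  have up: "?v l \<le> a \<longleftrightarrow> prefix_le n (suffix l (w \<frown> x)) \<alpha>" if "l < length w" for l
    using list_le_iff_prefix[of "?v l" a] len[of l] that prefix_le_cong[OF veq[OF that] aeq] by simp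
  have low: "reflect m a \<le> ?v l \<longleftrightarrow> prefix_le n (reflect_seq m (suffix l (w \<frown> x))) \<alpha>"
    if "l < length w" for l
  proof -
    have "reflect m a \<le> ?v l \<longleftrightarrow> prefix_le n ((!) (reflect m a)) ((!) (?v l))"
      using list_le_iff_prefix[of "reflect m a" "?v l"] len[of l] that by (simp only: rlen less_imp_le)
    also have "\<dots> \<longleftrightarrow> prefix_le n (reflect_seq m \<alpha>) (suffix l (w \<frown> x))"
      by (rule prefix_le_cong[OF req veq[OF that]])
    also have "\<dots> \<longleftrightarrow> prefix_le n (reflect_seq m (suffix l (w \<frown> x))) \<alpha>"
      by (rule prefix_le_reflect_seq[OF digits suffix_digit_seqs[OF dig]])
    finally show ?thesis .
  qed
  \<comment> \<open>At \<open>l = length w\<close> the window is \<open>a\<close> itself, so both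
    conditions hold there; this accounts for the strict range of \<open>l\<close> on the
    right.\<close>
  have "reflect m a \<le> a"
    using list_le_iff_prefix[of "reflect m a" a] prefix_le_cong[OF req aeq]
      not_less_fun_prefix[OF less_fun_asym[OF reflect_suffix_less[of 0]]] by (simp add: reflect_def)
  then have last: "?v (length w) \<le> a" "reflect m a \<le> ?v (length w)" by simp_all
  have split: "(\<forall>l\<in>{1..length w}. P l) \<longleftrightarrow> (\<forall>l. 0 < l \<longrightarrow> l < length w \<longrightarrow> P l) \<and> P (length w)" for P
  proof -
    have "l \<in> {1..length w} \<longleftrightarrow> 0 < l \<and> l < length w \<or> l = length w" for l
      using True by (cases w) auto
    then show ?thesis unfolding Ball_def by blast
  qed
  have inner: "(\<forall>l. 0 < l \<longrightarrow> l < length w \<longrightarrow>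
        (take l w \<noteq> replicate l m \<longrightarrow> ?v l \<le> a) \<and> (take l w \<noteq> replicate l 0 \<longrightarrow> reflect m a \<le> ?v l)) \<longleftrightarrow>
      (\<forall>l. 0 < l \<longrightarrow> l < length w \<longrightarrow>
        (take l w \<noteq> replicate l m \<longrightarrow> prefix_le n (suffix l (w \<frown> x)) \<alpha>) \<and>
        (take l w \<noteq> replicate l 0 \<longrightarrow> prefix_le n (reflect_seq m (suffix l (w \<frown> x))) \<alpha>))"
    by (simp only: up low cong: imp_cong)
  show ?thesis
    unfolding matched_def split inner using last True by (simp only: simp_thms)
qed (auto simp: matched_def)

lemma prefix_le_less_\<tau>: "prefix_le n x \<alpha> \<Longrightarrow> less_fun x \<tau>"
  using \<alpha>_less_\<tau> prefix_less_imp_less_fun less_fun_trans prefix_less_cong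
  unfolding prefix_eq_def by metis

text \<open>The condition for \<alpha> fails right behind \<open>w\<close>, whose last letter is
  below \<open>m\<close> and whose continuation is at least \<alpha>. For \<tau>, windows that start
  in \<open>w\<close> are at most \<alpha> on \<open>n\<close> letters, where \<tau> is already
  larger; later shifts lie in \<open>tails\<close>.\<close>

lemma has_form_imp_lex:
  assumes "has_form m a b" "b \<in> digit_seqs m"
  shows "lex_univoque m \<tau> b" "\<not> lex_univoque m \<alpha> b"
proof -
  obtain w x where w: "matched m a w" and b: "b = w \<frown> x" and x: "x = \<alpha> \<or> tail_form 0 x"
    using assms(1) has_form_iff by blast
  have xt: "x \<in> tails" using x \<alpha>_tails tail_form_tails by blast
  have xs: "x j = \<alpha> j" if "Suc j < n" for j using x that starts_0_base tail_form_starts by blast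
  have ge: "\<not> less_fun x \<alpha>"
    using x less_fun_irrefl less_fun_asym starts_0_greater tail_form_starts by blast
  let ?p = "length w"
  have m: "w \<noteq> []" "last w < m" "\<And>l. 0 < l \<Longrightarrow> l < ?p \<Longrightarrow> take l w \<noteq> replicate l m \<Longrightarrow> prefix_le n (suffix l b) \<alpha>"
    "\<And>l. 0 < l \<Longrightarrow> l < ?p \<Longrightarrow> take l w \<noteq> replicate l 0 \<Longrightarrow> prefix_le n (reflect_seq m (suffix l b)) \<alpha>"
    using w matched_iff[OF xs tails_digits[OF xt]] unfolding b by blast+
  \<comment> \<open>The digit just before the shift rules out the constant prefixes that
    \<open>matched\<close> exempts.\<close>
  have ne: "take (Suc k) w \<noteq> replicate (Suc k) d" if "b k \<noteq> d" "Suc k < ?p" for k d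
  proof
    assume "take (Suc k) w = replicate (Suc k) d"
    then have "take (Suc k) w ! k = d" by (metis lessI nth_replicate)
    then show False using that by (simp add: b)
  qed
  have tail: "suffix (Suc k) b \<in> tails" if "?p \<le> Suc k" for k
  proof -
    have "suffix (Suc k) b = suffix (Suc k - ?p) x" using that by (simp add: b fun_eq_iff)
    then show ?thesis using tails_suffix[OF xt] by simp
  qed
  show "lex_univoque m \<tau> b"
    unfolding lex_univoque_def
  proof (intro conjI allI impI)
    fix k assume "b k < m"
    then show "less_fun (suffix (Suc k) b) \<tau>"
      using tail[of k] tails_less m(3)[of "Suc k"] ne[of k m] prefix_le_less_\<tau>
      by (cases "?p \<le> Suc k") auto
  next
    fix k assume "0 < b k"
    then show "less_fun (reflect_seq m (suffix (Suc k) b)) \<tau>"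
      using tail[of k] tails_reflect_seq tails_less m(4)[of "Suc k"] ne[of k 0] prefix_le_less_\<tau>
      by (cases "?p \<le> Suc k") auto
  qed
  have "b (?p - 1) < m" using m(1,2) by (simp add: b last_conv_nth)
  moreover have "suffix (Suc (?p - 1)) b = x" using m(1) by (simp add: b)
  ultimately show "\<not> lex_univoque m \<alpha> b" using ge unfolding lex_univoque_def by metis
qed

section \<open>The first violation of the condition for \<alpha>\<close>

definition violation :: "nat word \<Rightarrow> nat \<Rightarrow> bool" where
  "violation b i \<longleftrightarrow> b i < m \<and> \<not> less_fun (suffix (Suc i) b) \<alpha>"

lemma not_lex_iff_violation:
  assumes "b \<in> digit_seqs m"
  shows "\<not> lex_univoque m \<alpha> b \<longleftrightarrow> (\<exists>i. violation b i \<or> violation (reflect_seq m b) i)"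
proof -
  have "(reflect_seq m b k < m) = (0 < b k)" for k
    using digit_seqsD[OF assms, of k] by (auto simp: reflect_seq_def)
  then show ?thesis unfolding lex_univoque_def violation_def by auto
qed

text \<open>The bound starts at a digit other than \<open>m\<close> and persists through runs of
  \<open>m\<close>; hence the exemption of the prefixes made of \<open>m\<close> only in
  \<open>matched\<close>.\<close>

lemma no_violation_suffix_less:
  assumes "b \<in> digit_seqs m" "\<And>k. k < i \<Longrightarrow> \<not> violation b k" "l \<le> i" "j < l" "b j \<noteq> m"
  shows "less_fun (suffix l b) \<alpha>"
  using assms(3,4)
proof (induction l)
  case (Suc k)
  show ?case
  proof (cases "b k < m")
    case True
    have "\<not> violation b k" using assms(2)[of k] Suc.prems by simp
    then show ?thesis using True unfolding violation_def by blast
  next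
    case False
    then have bk: "b k = m" using digit_seqsD[OF assms(1), of k] by simp
    then have "j < k" using Suc.prems assms(5) by (auto simp: less_Suc_eq)
    then have "less_fun (suffix k b) \<alpha>" by (intro Suc.IH) (use Suc.prems in auto)
    with assms(1) bk show ?thesis by (rule less_fun_suffix_of_top_digit)
  qed
qed simp

text \<open>Being at least \<alpha>, the tail has a reflection at most that of \<alpha>, hence below
  \<tau>. From there both bounds pass through all shifts, by the condition for \<tau> or across a
  top digit.\<close>

lemma violation_tails:
  assumes b: "b \<in> digit_seqs m" "lex_univoque m \<tau> b" and i: "violation b i"
  shows "suffix (Suc i) b \<in> tails"
proof -
  let ?x = "suffix (Suc i) b"
  have d: "?x \<in> digit_seqs m" using b(1) by (rule suffix_digit_seqs)
  have up: "less_fun (suffix k ?x) \<tau>" for k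
  proof (induction k)
    case 0
    show ?case unfolding suffix_0 using b(2) i unfolding lex_univoque_def violation_def by blast
  next
    case (Suc k)
    show ?case
    proof (cases "?x k < m")
      case True
      then have "b (Suc i + k) < m" by simp
      then have "less_fun (suffix (Suc (Suc i + k)) b) \<tau>"
        using b(2) unfolding lex_univoque_def by blast
      then show ?thesis unfolding suffix_suffix add_Suc_right .
    next
      case False
      then have "?x k = m" using digit_seqsD[OF d, of k] by simp
      with d show ?thesis using Suc.IH by (rule less_fun_suffix_of_top_digit)
    qed
  qed
  have down: "less_fun (suffix k (reflect_seq m ?x)) \<tau>" for k
  proof (induction k)
    case 0
    have "\<not> less_fun (reflect_seq m \<alpha>) (reflect_seq m ?x)"
      using less_fun_reflect_seq[OF digits d] i by (simp add: violation_def)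
    moreover have "less_fun (reflect_seq m \<alpha>) \<tau>"
      using reflect_suffix_less[of 0] \<alpha>_less_fun_\<tau> less_fun_trans unfolding suffix_0 by blast
    ultimately show ?case unfolding suffix_0 by (rule not_less_fun_less_fun_trans)
  next
    case (Suc k)
    show ?case
    proof (cases "0 < ?x k")
      case True
      then have "0 < b (Suc i + k)" by simp
      then have "less_fun (reflect_seq m (suffix (Suc (Suc i + k)) b)) \<tau>"
        using b(2) unfolding lex_univoque_def by blast
      then show ?thesis unfolding suffix_reflect_seq suffix_suffix add_Suc_right .
    next
      case False
      then have "reflect_seq m ?x k = m" by (simp add: reflect_seq_def)
      show ?thesis
        by (rule less_fun_suffix_of_top_digit[OF reflect_seq_digit_seqs]) fact+
    qed
  qed
  show ?thesis unfolding tails_def using d up down by auto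
qed

text \<open>At the first letter above \<alpha>, its period is still bounded by \<tau>. Within a
  period \<tau> exceeds \<alpha> only in the last letter, so this period is exactly
  \<open>c 0\<close> and all earlier ones are \<open>a\<close>.\<close>

lemma tails_split_periodic:
  assumes x: "x \<in> tails" "\<not> less_fun x \<alpha>"
  obtains p y where "x = concat (replicate p a) \<frown> y" "y = \<alpha> \<or> tail_form 0 y"
proof (cases "x = \<alpha>")
  case True
  then show ?thesis using that[of 0 \<alpha>] by simp
next
  case False
  then have "less_fun \<alpha> x" using x(2) less_fun_linear by blast
  then obtain k where k: "\<alpha> k < x k" "\<forall>j<k. \<alpha> j = x j" unfolding less_fun_def by auto
  define p where "p = k div n"
  define s where "s = k mod n"
  define y where "y = suffix (p * n) x"
  have kk: "k = p * n + s" by (simp add: p_def s_def)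
  have s: "s < n" using n_pos by (simp add: s_def)
  have per: "\<alpha> (p * n + j) = \<alpha> j" for j using n_pos by simp
  have ys: "\<forall>j<s. y j = \<alpha> j" using k(2) per by (metis kk nat_add_left_cancel_less suffix_nth y_def)
  have yt: "y \<in> tails" unfolding y_def using x(1) by (rule tails_suffix)
  have gt: "\<alpha> s < y s" using k(1) per by (simp add: kk y_def del: iter_nth)
  have le: "y s \<le> \<tau> s"
  proof (rule ccontr)
    assume "\<not> y s \<le> \<tau> s"
    then have "\<tau> s < y s \<and> (\<forall>j<s. \<tau> j = y j)" using ys s by (auto simp: \<tau>_base simp del: iter_nth)
    then have "less_fun \<tau> y" unfolding less_fun_def by blast
    then show False using tails_less[OF yt] less_fun_asym by blast
  qed
  have sn: "Suc s = n" using gt le s \<tau>_base[of s] by (auto split: if_splits)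
  have "starts 0 y"
    unfolding starts_def N_0
  proof (intro allI impI)
    fix j assume "j < n"
    then consider "j < s" | "j = s" using sn by linarith
    then show "y j = \<tau> j"
      using ys gt le \<tau>_base[of j] sn by cases (auto simp del: iter_nth)
  qed
  then have "tail_form 0 y" by (rule tails_tail_form[OF yt])
  moreover have "x = concat (replicate p a) \<frown> y"
  proof
    fix j
    show "x j = (concat (replicate p a) \<frown> y) j"
    proof (cases "j < p * n")
      case True
      then have "x j = \<alpha> j" using k(2) kk by simp
      then show ?thesis using True n_pos nth_concat_replicate[of j p a]
        by (simp add: conc_def length_concat_replicate)
    next
      case False
      then show ?thesis by (simp add: conc_def length_concat_replicate y_def)
    qed
  qed
  ultimately show ?thesis using that by blast
qed

text \<open>The finitely many copies of \<open>a\<close> behind the violation join \<open>w\<close>,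
  as the form allows only exponents 0 and \<infinity> for \<open>a\<close>. Windows starting before
  them are controlled by minimality of \<open>i\<close>, those starting inside them by the shifts of
  \<alpha>.\<close>

lemma violation_has_form:
  assumes b: "b \<in> digit_seqs m" "lex_univoque m \<tau> b" and i: "violation b i"
    and min: "\<And>k. k < i \<Longrightarrow> \<not> violation b k" "\<And>k. k < i \<Longrightarrow> \<not> violation (reflect_seq m b) k"
  shows "has_form m a b"
proof -
  let ?x = "suffix (Suc i) b"
  have xt: "?x \<in> tails" by (rule violation_tails[OF b i])
  have "\<not> less_fun ?x \<alpha>" using i by (simp add: violation_def)
  then obtain p y where y: "?x = concat (replicate p a) \<frown> y" "y = \<alpha> \<or> tail_form 0 y"
    using tails_split_periodic[OF xt] by blast
  have yt: "y \<in> tails" using y(2) \<alpha>_tails tail_form_tails by blast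
  have ys: "y j = \<alpha> j" if "Suc j < n" for j using y(2) that starts_0_base tail_form_starts by blast
  define w where "w = prefix (Suc i) b @ concat (replicate p a)"
  have lw: "length w = Suc i + p * n" by (simp add: w_def length_concat_replicate)
  have bw: "b = w \<frown> y"
    using y(1) prefix_suffix[of b "Suc i"] by (simp only: w_def conc_conc[symmetric])
  have wn: "w ! k = b k" if "k < length w" for k using that by (subst bw) simp
  have "set w \<subseteq> {0..m}"
    using wn digit_seqsD[OF b(1)] by (metis atLeast0AtMost atMost_iff in_set_conv_nth subsetI)
  moreover have "w \<noteq> []" by (simp add: w_def)
  moreover have "last w < m"
  proof (cases p)
    case 0
    then show ?thesis using i by (simp add: w_def violation_def)
  next
    case (Suc p')
    then have "w = (prefix (Suc i) b @ concat (replicate p' a)) @ a"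
      by (simp only: w_def concat_replicate_Suc_right append.assoc)
    then show ?thesis using last_less nonempty by simp
  qed
  moreover have "(take l w \<noteq> replicate l m \<longrightarrow> prefix_le n (suffix l (w \<frown> y)) \<alpha>) \<and>
      (take l w \<noteq> replicate l 0 \<longrightarrow> prefix_le n (reflect_seq m (suffix l (w \<frown> y))) \<alpha>)"
    if l: "0 < l" "l < length w" for l
  proof (cases "l \<le> i")
    case True
    have ex: "\<exists>j<l. b j \<noteq> d" if ne: "take l w \<noteq> replicate l d" for d
    proof (rule ccontr)
      assume "\<not> ?thesis"
      then have "take l w = replicate l d" using l(2) wn by (intro nth_equalityI) auto
      with ne show False ..
    qed
    show ?thesis
    proof (intro conjI impI)
      assume "take l w \<noteq> replicate l m"
      then obtain j where "j < l" "b j \<noteq> m" using ex by blast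
      then have "less_fun (suffix l b) \<alpha>"
        by (intro no_violation_suffix_less[OF b(1) min(1) True])
      then show "prefix_le n (suffix l (w \<frown> y)) \<alpha>"
        unfolding bw[symmetric] by (intro not_less_fun_prefix less_fun_asym)
    next
      assume "take l w \<noteq> replicate l 0"
      then obtain j where j: "j < l" "b j \<noteq> 0" using ex by blast
      then have "reflect_seq m b j \<noteq> m"
        using digit_seqsD[OF b(1), of j] by (simp add: reflect_seq_def)
      then have "less_fun (suffix l (reflect_seq m b)) \<alpha>"
        by (intro no_violation_suffix_less[OF reflect_seq_digit_seqs min(2) True j(1)])
      then show "prefix_le n (reflect_seq m (suffix l (w \<frown> y))) \<alpha>"
        unfolding bw[symmetric] suffix_reflect_seq by (intro not_less_fun_prefix less_fun_asym)
    qed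
  next
    case False
    define l' where "l' = l - Suc i"
    have l': "l = Suc i + l'" "l' < p * n" using False l lw by (auto simp: l'_def)
    \<comment> \<open>The window enters \<open>y\<close> by at most \<open>n - 1\<close> letters, on
      which \<open>y\<close> agrees with \<alpha>.\<close>
    have "suffix l b j = suffix l' \<alpha> j" if j: "j < n" for j
    proof -
      have "?x (l' + j) = \<alpha> (l' + j)"
      proof (cases "l' + j < p * n")
        case True
        then show ?thesis unfolding y(1) using nth_concat_replicate[of "l' + j" p a] n_pos
          by (simp add: length_concat_replicate)
      next
        case False
        then have s: "Suc (l' + j - p * n) < n" using j l'(2) by simp
        have "\<alpha> (l' + j - p * n) = \<alpha> (l' + j)"
          using False n_pos by (simp add: not_less) (metis le_add_diff_inverse2 mod_mult_self1)
        then show ?thesis unfolding y(1) using ys[OF s] False by (simp add: length_concat_replicate)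
      qed
      then show ?thesis by (simp add: l'(1) add.assoc)
    qed
    then have eq: "prefix_eq n (suffix l' \<alpha>) (suffix l b)"
      "prefix_eq n (reflect_seq m (suffix l' \<alpha>)) (reflect_seq m (suffix l b))"
      by (auto simp: prefix_eq_def reflect_seq_def simp del: suffix_nth)
    have refl: "prefix_eq n \<alpha> \<alpha>" by (simp add: prefix_eq_def)
    have "prefix_le n (suffix l b) \<alpha>"
      using prefix_le_cong[OF eq(1) refl] not_less_fun_prefix[OF \<alpha>_suffix_le] by blast
    moreover have "prefix_le n (reflect_seq m (suffix l b)) \<alpha>"
      using prefix_le_cong[OF eq(2) refl]
        not_less_fun_prefix[OF less_fun_asym[OF reflect_suffix_less]] by blast
    ultimately show ?thesis unfolding bw[symmetric] by blast
  qed
  ultimately have "matched m a w" using matched_iff[OF ys tails_digits[OF yt]] by blast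
  then show ?thesis unfolding has_form_iff using bw y(2) by blast
qed

text \<open>Taking the least violation over \<open>b\<close> and its reflection together decides
  which of the two has the form and supplies both halves of matchedness.\<close>

lemma lex_univoque_difference_iff:
  assumes b: "b \<in> digit_seqs m"
  shows "lex_univoque m \<tau> b \<and> \<not> lex_univoque m \<alpha> b \<longleftrightarrow>
    has_form m a b \<or> has_form m a (reflect_seq m b)"
proof
  assume lex: "lex_univoque m \<tau> b \<and> \<not> lex_univoque m \<alpha> b"
  then have ex: "\<exists>i. violation b i \<or> violation (reflect_seq m b) i"
    using not_lex_iff_violation[OF b] by blast
  define i where "i = (LEAST i. violation b i \<or> violation (reflect_seq m b) i)"
  have i: "violation b i \<or> violation (reflect_seq m b) i"
    unfolding i_def using ex by (rule LeastI_ex)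
  have min: "\<not> violation b k" "\<not> violation (reflect_seq m b) k" if "k < i" for k
    using not_less_Least that unfolding i_def by blast+
  from i show "has_form m a b \<or> has_form m a (reflect_seq m b)"
  proof
    assume "violation b i"
    then show ?thesis using violation_has_form[OF b _ _ min] lex by blast
  next
    assume v: "violation (reflect_seq m b) i"
    have "has_form m a (reflect_seq m b)"
      by (rule violation_has_form[OF reflect_seq_digit_seqs _ v])
        (use min b lex in \<open>auto simp: lex_univoque_reflect_seq\<close>)
    then show ?thesis ..
  qed
next
  assume "has_form m a b \<or> has_form m a (reflect_seq m b)"
  then show "lex_univoque m \<tau> b \<and> \<not> lex_univoque m \<alpha> b"
    using has_form_imp_lex[of b] has_form_imp_lex[of "reflect_seq m b"] b
    by (auto simp: lex_univoque_reflect_seq)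
qed

end

section \<open>The next univoque base\<close>

text \<open>The large first digit settles the shift by 0; a digit 0, behind which the condition is
  silent, reflects to the top digit.\<close>

lemma reflect_suffix_less_of_lex_univoque:
  assumes "\<beta> \<in> digit_seqs m" "m < 2 * \<beta> 0" "lex_univoque m \<beta> \<beta>"
  shows "less_fun (reflect_seq m (suffix k \<beta>)) \<beta>"
proof (induction k)
  case 0
  have "reflect_seq m \<beta> 0 < \<beta> 0" using assms(2) by (simp add: reflect_seq_def)
  then show ?case unfolding suffix_0 less_fun_def by blast
next
  case (Suc k)
  show ?case
  proof (cases "0 < \<beta> k")
    case True
    then show ?thesis using assms(3) unfolding lex_univoque_def by blast
  next
    case False
    then have "reflect_seq m \<beta> k = m" by (simp add: reflect_seq_def)
    then show ?thesis
      using less_fun_suffix_of_top_digit[OF reflect_seq_digit_seqs] Suc.IH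
      unfolding suffix_reflect_seq by blast
  qed
qed

text \<open>Here the threshold \<open>M\<close> enters: a first digit at most
  \<open>m div 2\<close>, with a tail worth at most 1, would make the total at most
  \<open>M / q\<close>, which is less than 1.\<close>

lemma quasi_greedy_first_digit:
  assumes "real (m div 2 + 1) < q" "q \<le> real m + 1" "1 \<le> m"
  shows "m < 2 * quasi_greedy m q 0"
proof (rule ccontr)
  assume "\<not> ?thesis"
  then have le: "quasi_greedy m q 0 \<le> m div 2" by simp
  then have "quasi_greedy m q 0 < m" using assms(3) by simp
  have q: "1 < q" using assms(1) by simp
  note P = quasi_greedy_props[OF q assms(2)]
  have "expansion_value q (suffix 1 (quasi_greedy m q)) \<le> 1"
    using P(4)[OF \<open>quasi_greedy m q 0 < m\<close>] by simp
  moreover have "1 = (real (quasi_greedy m q 0) + expansion_value q (suffix 1 (quasi_greedy m q))) / q"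
    using expansion_value_Suc[OF P(1) q, of 0] P(2) by simp
  ultimately show False using le assms(1) q by (simp add: field_simps)
qed

text \<open>The first \<open>L\<close> digits sum to less than 1 at \<open>q0\<close>, since nonzero
  digits follow, and by continuity also nearby. An expansion for \<open>q < q0\<close> dropping
  below them within \<open>L\<close> digits would have value at most this sum.\<close>

lemma quasi_greedy_left_continuous:
  assumes q0: "1 < q0" "q0 \<le> real m + 1"
  obtains \<delta> where "0 < \<delta>"
    "\<And>q j. 1 < q \<Longrightarrow> q0 - \<delta> < q \<Longrightarrow> q < q0 \<Longrightarrow> j < L \<Longrightarrow> quasi_greedy m q j = quasi_greedy m q0 j"
proof -
  let ?\<alpha> = "quasi_greedy m q0"
  note P = quasi_greedy_props[OF q0]
  define f where "f q = (\<Sum>i<L. real (?\<alpha> i) / q ^ Suc i)" for q :: real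
  obtain i where "0 < suffix L ?\<alpha> i" using P(3) by (rule infinite_nonzero_suffix)
  then have "0 < expansion_value q0 (suffix L ?\<alpha>)"
    by (rule expansion_value_pos[OF suffix_digit_seqs[OF P(1)] q0(1)])
  then have "0 < expansion_value q0 (suffix L ?\<alpha>) / q0 ^ L" using q0(1) by simp
  then have "f q0 < 1"
    using expansion_value_split[OF P(1) q0(1), of L] P(2) q0(1) by (simp add: f_def)
  moreover have "isCont f q0" unfolding f_def using q0(1) by (auto intro!: continuous_intros)
  ultimately have "\<forall>\<^sub>F q in at q0. f q < 1"
    unfolding isCont_def by (rule order_tendstoD(2)[rotated])
  then obtain \<delta> where \<delta>: "0 < \<delta>" "\<And>q. q \<noteq> q0 \<Longrightarrow> dist q q0 < \<delta> \<Longrightarrow> f q < 1"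
    unfolding eventually_at by auto
  show ?thesis
  proof (rule that[OF \<delta>(1)])
    fix q j assume q: "1 < q" "q0 - \<delta> < q" "q < q0" and j: "j < L"
    let ?\<beta> = "quasi_greedy m q"
    have qm: "q \<le> real m + 1" using q(3) q0(2) by simp
    note Q = quasi_greedy_props[OF q(1) qm]
    have fq: "f q < 1" using \<delta>(2)[of q] q by (simp add: dist_real_def)
    obtain k where k: "?\<beta> k < ?\<alpha> k" "\<forall>i<k. ?\<beta> i = ?\<alpha> i"
      using quasi_greedy_strict_mono[OF q(1,3) q0(2)] unfolding less_fun_def by auto
    have "\<not> k < L"
    proof
      assume kL: "k < L"
      have "?\<beta> k < m" using k(1) digit_seqsD[OF P(1), of k] by simp
      then have t: "expansion_value q (suffix (Suc k) ?\<beta>) \<le> 1" by (rule Q(4))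
      have "real (?\<beta> k) + 1 \<le> real (?\<alpha> k)" using k(1) by linarith
      then have "(real (?\<beta> k) + expansion_value q (suffix (Suc k) ?\<beta>)) / q ^ Suc k \<le> real (?\<alpha> k) / q ^ Suc k"
        using t q(1) by (intro divide_right_mono) auto
      then have "expansion_value q ?\<beta> \<le> (\<Sum>i<Suc k. real (?\<alpha> i) / q ^ Suc i)"
        unfolding expansion_value_split[OF Q(1) q(1), of "Suc k"] using k(2) by (simp add: add_divide_distrib)
      also have "\<dots> \<le> f q"
        unfolding f_def by (rule sum_mono2) (use kL q(1) in auto)
      finally show False using fq Q(2) by simp
    qed
    then show "?\<beta> j = ?\<alpha> j" using k(2) j by simp
  qed
qed

text \<open>Because of the gap on the right, \<open>q0\<close> is univoque or approached by univoque
  bases from the left. Their expansions share long prefixes with the one for \<open>q0\<close> and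
  would inherit a failure of the inequality.\<close>

lemma quasi_greedy_reflect_suffix_less:
  assumes m: "1 \<le> m" and q0: "real (m div 2 + 1) < q0" "q0 \<le> real m + 1"
    and cl: "q0 \<in> closure (univoque_bases m)" and gap: "q0 < q1" "{q0<..<q1} \<inter> univoque_bases m = {}"
  shows "less_fun (reflect_seq m (suffix i (quasi_greedy m q0))) (quasi_greedy m q0)"
proof (rule ccontr)
  let ?\<alpha> = "quasi_greedy m q0"
  have q01: "1 < q0" using q0(1) by simp
  note P = quasi_greedy_props[OF q01 q0(2)]
  assume nl: "\<not> ?thesis"
  have i: "0 < i"
  proof (rule ccontr)
    assume "\<not> 0 < i"
    moreover have "less_fun (reflect_seq m ?\<alpha>) ?\<alpha>"
      unfolding less_fun_def using quasi_greedy_first_digit[OF q0 m]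
      by (intro exI[of _ 0]) (simp add: reflect_seq_def)
    ultimately show False using nl by simp
  qed
  obtain L where L: "i < L" "?\<alpha> = reflect_seq m (suffix i ?\<alpha>) \<or>
      (\<exists>k. i + k < L \<and> ?\<alpha> k < reflect_seq m (suffix i ?\<alpha>) k \<and>
        (\<forall>j<k. ?\<alpha> j = reflect_seq m (suffix i ?\<alpha>) j))"
  proof (cases "?\<alpha> = reflect_seq m (suffix i ?\<alpha>)")
    case True
    then show ?thesis using that[of "Suc i"] by blast
  next
    case False
    then have "less_fun ?\<alpha> (reflect_seq m (suffix i ?\<alpha>))" using nl less_fun_linear by metis
    then obtain k where "?\<alpha> k < reflect_seq m (suffix i ?\<alpha>) k"
      "\<forall>j<k. ?\<alpha> j = reflect_seq m (suffix i ?\<alpha>) j" unfolding less_fun_def by blast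
    then show ?thesis using that[of "Suc (i + k)"] by (metis less_Suc_eq_le le_add1 lessI)
  qed
  obtain \<delta> where \<delta>: "0 < \<delta>"
    "\<And>q j. 1 < q \<Longrightarrow> q0 - \<delta> < q \<Longrightarrow> q < q0 \<Longrightarrow> j < L \<Longrightarrow> quasi_greedy m q j = ?\<alpha> j"
    using quasi_greedy_left_continuous[OF q01 q0(2)] by blast
  \<comment> \<open>The three bounds keep the first \<open>L\<close> digits, stay left of
    \<open>q1\<close>, and stay above the threshold for a large first digit.\<close>
  define \<epsilon> where "\<epsilon> = min \<delta> (min (q1 - q0) (q0 - real (m div 2 + 1)))"
  have "0 < \<epsilon>" using \<delta>(1) gap(1) q0(1) by (simp add: \<epsilon>_def)
  then obtain q where qU: "q \<in> univoque_bases m" and "dist q q0 < \<epsilon>"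
    using cl unfolding closure_approachable by blast
  then have q: "q0 - \<delta> < q" "q < q1" "real (m div 2 + 1) < q"
    by (auto simp: \<epsilon>_def dist_real_def abs_less_iff)
  have qle: "q \<le> q0" using gap(2) qU q(2) by (metis disjoint_iff greaterThanLessThan_iff not_le)
  have q': "1 < q" "q \<le> real m + 1" using q(3) qle q0(2) by auto
  let ?\<beta> = "quasi_greedy m q"
  note Q = quasi_greedy_props[OF q']
  have R: "less_fun (reflect_seq m (suffix i ?\<beta>)) ?\<beta>"
    using reflect_suffix_less_of_lex_univoque[OF Q(1) quasi_greedy_first_digit[OF q(3) q'(2) m]]
      qU univoque_bases_iff by blast
  have "q \<noteq> q0" using R nl by blast
  then have lt: "q < q0" using qle by simp
  have eq: "?\<beta> j = ?\<alpha> j" if "j < L" for j using \<delta>(2) q'(1) q(1) lt that by blast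
  have "less_fun ?\<beta> (reflect_seq m (suffix i ?\<beta>))"
    using L(2)
  proof
    assume "\<exists>k. i + k < L \<and> ?\<alpha> k < reflect_seq m (suffix i ?\<alpha>) k \<and>
        (\<forall>j<k. ?\<alpha> j = reflect_seq m (suffix i ?\<alpha>) j)"
    then obtain k where k: "i + k < L" "?\<alpha> k < reflect_seq m (suffix i ?\<alpha>) k"
      "\<forall>j<k. ?\<alpha> j = reflect_seq m (suffix i ?\<alpha>) j" by blast
    show ?thesis unfolding less_fun_def
      by (rule exI[of _ k]) (use k eq in \<open>auto simp: reflect_seq_def\<close>)
  next
    \<comment> \<open>In case of equality no finite prefix shows a failure. Instead, the first drop
      of \<open>?\<beta>\<close> below \<open>?\<alpha>\<close>, at \<open>p\<close>, becomes under
      reflection and shift an excess at \<open>p - i\<close>.\<close>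
    assume "?\<alpha> = reflect_seq m (suffix i ?\<alpha>)"
    then have s: "?\<alpha> j = m - ?\<alpha> (i + j)" for j by (metis reflect_seq_def suffix_nth)
    obtain p where p: "?\<beta> p < ?\<alpha> p" "\<forall>j<p. ?\<beta> j = ?\<alpha> j"
      using quasi_greedy_strict_mono[OF q'(1) lt q0(2)] unfolding less_fun_def by auto
    have "L \<le> p" using p(1) eq[of p] by (metis less_irrefl not_le)
    then have ip: "i < p" using L(1) by simp
    have "?\<beta> (p - i) < reflect_seq m (suffix i ?\<beta>) (p - i)"
      using s[of "p - i"] p ip i digit_seqsD[OF P(1), of p] by (simp add: reflect_seq_def)
    moreover have "\<forall>j<p - i. ?\<beta> j = reflect_seq m (suffix i ?\<beta>) j"
    proof (intro allI impI)
      fix j assume "j < p - i"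
      then show "?\<beta> j = reflect_seq m (suffix i ?\<beta>) j"
        using s[of j] p(2) by (simp add: reflect_seq_def)
    qed
    ultimately show ?thesis unfolding less_fun_def by blast
  qed
  then show False using R less_fun_asym by blast
qed

text \<open>The value is a power series in \<open>1 / q\<close>; a base strictly between 1 and
  \<open>l\<close> supplies a larger point of convergence.\<close>

lemma continuous_on_expansion_value:
  assumes "c \<in> digit_seqs m" "1 < l"
  shows "continuous_on {l..} (\<lambda>q. expansion_value q c)"
proof -
  have eq: "expansion_value q c = (1 / q) * (\<Sum>i. real (c i) * (1 / q) ^ i)" if "l \<le> q" for q
  proof -
    have "1 < q" using that assms(2) by simp
    have s: "summable (\<lambda>i. real (c i) / q ^ Suc i)" by (rule summable_digits[OF assms(1) \<open>1 < q\<close>])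
    have "(\<Sum>i. real (c i) * (1 / q) ^ i) = (\<Sum>i. q * (real (c i) / q ^ Suc i))"
      using \<open>1 < q\<close> by (simp add: power_one_over)
    also have "\<dots> = q * expansion_value q c"
      unfolding expansion_value_def using s by (rule suminf_mult)
    finally show ?thesis using \<open>1 < q\<close> by simp
  qed
  obtain k where k: "1 < k" "k < l" using dense[OF assms(2)] by blast
  have "summable (\<lambda>i. k * (real (c i) / k ^ Suc i))"
    by (rule summable_mult[OF summable_digits[OF assms(1) k(1)]])
  then have sk: "summable (\<lambda>i. real (c i) * (1 / k) ^ i)" using k(1) by (simp add: power_one_over)
  have "isCont (\<lambda>q. (1 / q) * (\<Sum>i. real (c i) * (1 / q) ^ i)) q" if "l \<le> q" for q
  proof -
    have "norm (1 / q) < norm (1 / k)" using that k by (simp add: field_simps)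
    then have "isCont (\<lambda>x. \<Sum>i. real (c i) * x ^ i) (1 / q)" by (rule isCont_powser[OF sk])
    moreover have q: "isCont (\<lambda>q. 1 / q) q" using that assms(2) by (intro continuous_intros) auto
    ultimately have "isCont (\<lambda>q. \<Sum>i. real (c i) * (1 / q) ^ i) q" using isCont_o2[OF q] by blast
    then show ?thesis using q by (intro continuous_mult)
  qed
  then have "continuous_on {l..} (\<lambda>q. (1 / q) * (\<Sum>i. real (c i) * (1 / q) ^ i))"
    by (intro continuous_at_imp_continuous_on) auto
  then show ?thesis by (rule continuous_on_eq) (use eq in auto)
qed

context admissible_word
begin

text \<open>
  A self-admissible sequence strictly between \<open>a\<^sup>\<omega>\<close> and \<open>\<tau>\<close> can only be some
  \<open>(c\<^sub>f r\<^sub>f)\<^sup>\<omega>\<close>, whose shift by half a period is its own reflection.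
\<close>

lemma no_univoque_between:
  assumes \<beta>: "less_fun \<alpha> \<beta>" "less_fun \<beta> \<tau>" "\<beta> \<in> digit_seqs m"
    and up: "\<And>k. \<not> less_fun \<beta> (suffix k \<beta>)"
    and down: "\<And>k. less_fun (reflect_seq m (suffix k \<beta>)) \<beta>"
  shows False
proof -
  have bt: "\<beta> \<in> tails"
    unfolding tails_def
    using \<beta>(2,3) up down not_less_fun_less_fun_trans less_fun_trans by blast
  obtain p y where y: "\<beta> = concat (replicate p a) \<frown> y" "y = \<alpha> \<or> tail_form 0 y"
    using tails_split_periodic[OF bt less_fun_asym[OF \<beta>(1)]] .
  have sy: "suffix (p * n) \<beta> = y"
    unfolding y(1) by (rule ext) (simp add: length_concat_replicate)
  have ba: "\<beta> j = \<alpha> j" if "j < p * n" for j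
    unfolding y(1) using that nth_concat_replicate[of j p a] n_pos by (simp add: length_concat_replicate)
  have "less_fun (suffix (p * n) \<alpha>) (suffix (p * n) \<beta>)"
    by (subst less_fun_suffix_iff) (use ba \<beta>(1) in \<open>auto simp del: iter_nth\<close>)
  then have "less_fun \<alpha> y" using sy \<alpha>_suffix_mod[of "p * n"] by simp
  then have "tail_form 0 y" using y(2) less_fun_irrefl by blast
  then have y0: "starts 0 y" by (rule tail_form_starts)
  \<comment> \<open>Otherwise \<beta> begins with \<open>a\<close>, but its shift \<open>y\<close>
    begins with the larger \<open>c 0\<close>.\<close>
  have "p = 0"
  proof (rule ccontr)
    assume "p \<noteq> 0"
    then have bn: "\<beta> j = \<alpha> j" if "j < n" for j
      using ba that by (metis less_le_trans mult_le_mono1 nat_mult_1 One_nat_def Suc_leI gr0I)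
    have "less_fun \<beta> y"
      unfolding less_fun_def
      by (rule exI[of _ "n - 1"])
        (use bn y0 n_pos in \<open>auto simp: starts_def N_0 \<tau>_base simp del: iter_nth\<close>)
    then show False using up[of "p * n"] sy by simp
  qed
  then have b0: "starts 0 \<beta>" using y(1) y0 by simp
  obtain f where f: "starts f \<beta>" "starts f (reflect_seq m (suffix (N f) \<beta>))"
    using block_step[OF bt b0] by blast
  have bf: "\<beta> (N f + j) = m - \<tau> j" if "j < N f" for j
  proof -
    have "m - \<beta> (N f + j) = \<tau> j" using f(2) that by (simp add: starts_def reflect_seq_def)
    then show ?thesis using digit_seqsD[OF \<beta>(3), of "N f + j"] by simp
  qed
  \<comment> \<open>\<beta> begins with \<open>c f\<close> followed by \<open>r f\<close>, which is
    below \<open>c (Suc f)\<close>; so any shift or reflected shift starting with a later block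
    contradicts \<open>up\<close> or \<open>down\<close>.\<close>
  have greater: "less_fun \<beta> u" if u: "starts i u" "f < i" for u i
  proof -
    have uS: "starts (Suc f) u" using starts_mono[OF _ u(1), of "Suc f"] u(2) by simp
    have "\<beta> (N f + (N f - 1)) < u (N f + (N f - 1))"
      using uS bf[of "N f - 1"] \<tau>_step[of "N f - 1" f] N_pos[of f] by (simp add: starts_def N_Suc)
    moreover have "\<beta> j = u j" if j: "j < N f + (N f - 1)" for j
    proof (cases "j < N f")
      case True
      then show ?thesis using f(1) uS by (simp add: starts_def N_Suc)
    next
      case False
      then have "Suc (j - N f) < N f" "j = N f + (j - N f)" using j by auto
      then have "\<beta> j = \<tau> j" using bf[of "j - N f"] \<tau>_step[of "j - N f" f] by auto
      then show ?thesis using uS j by (simp add: starts_def N_Suc)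
    qed
    ultimately show ?thesis unfolding less_fun_def by blast
  qed
  consider "\<beta> = (c f @ r f)\<^sup>\<omega>"
    | j l i y where "f < i" "l \<le> (1::nat)" "starts i y" "y \<in> tails"
      "\<beta> = (concat (replicate j (c f @ r f)) @ concat (replicate l (c f @ r i))) \<frown> y"
    using tails_step[OF bt f(1)] by blast
  then show False
  proof cases
    case 1
    let ?w = "c f @ r f"
    have lw: "length ?w = N f + N f" by simp
    have "reflect_seq m (suffix (N f) \<beta>) j = \<beta> j" for j
    proof -
      have b: "\<beta> i = ?w ! (i mod (N f + N f))" for i
      proof -
        have "0 < length ?w" using N_pos[of f] lw by simp
        then show ?thesis unfolding 1 by (simp only: iter_nth lw)
      qed
      define i where "i = j mod (N f + N f)"
      have i: "i < N f + N f" using N_pos[of f] by (simp add: i_def)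
      have m: "(N f + j) mod (N f + N f) = (N f + i) mod (N f + N f)"
        by (simp add: i_def mod_add_right_eq)
      show ?thesis
      proof (cases "i < N f")
        case True
        then have "(N f + j) mod (N f + N f) = N f + i" using m by simp
        then show ?thesis
          using b[of j] b[of "N f + j"] True digit_seqsD[OF \<tau>_digits, of i]
          by (simp add: reflect_seq_def i_def[symmetric] nth_append r_nth cword_nth)
      next
        case False
        then have "(N f + j) mod (N f + N f) = i - N f" using m i by (simp add: le_mod_geq)
        then show ?thesis
          using b[of j] b[of "N f + j"] False i
          by (simp add: reflect_seq_def i_def[symmetric] nth_append r_nth cword_nth)
      qed
    qed
    then have "reflect_seq m (suffix (N f) \<beta>) = \<beta>" by blast
    then show False using down[of "N f"] less_fun_irrefl[of \<beta>] by simp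
  next
    case 2
    let ?u = "concat (replicate j (c f @ r f))"
    consider "l = 0" | "l = 1" using 2(2) by linarith
    then show False
    proof cases
      case 1
      then have "suffix (length ?u) \<beta> = y" unfolding 2(5) by simp
      then show False using greater[OF 2(3,1)] up[of "length ?u"] by simp
    next
      case l: 2
      have "\<beta> = (?u @ c f) \<frown> (r i \<frown> y)" unfolding 2(5) l by simp
      then have "suffix (length (?u @ c f)) \<beta> = r i \<frown> y" by (metis suffix_conc_length)
      moreover have "starts i (reflect_seq m (r i \<frown> y))"
        using digit_seqsD[OF \<tau>_digits] by (simp add: starts_def reflect_seq_def r_nth)
      ultimately show False
        using greater[OF _ 2(1)] down[of "length (?u @ c f)"] less_fun_asym by metis
    qed
  qed
qed

lemma \<tau>_infinite: "infinite {i. \<tau> i \<noteq> 0}"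
  unfolding infinite_nat_iff_unbounded_le
proof
  fix k
  have "k \<le> N k - 1" "\<tau> (N k - 1) \<noteq> 0" using less_N[of k] \<tau>_last_pos[of k] by auto
  then show "\<exists>i\<ge>k. i \<in> {i. \<tau> i \<noteq> 0}" by blast
qed

lemma \<tau>_lex_univoque: "lex_univoque m \<tau> \<tau>"
  unfolding lex_univoque_def using \<tau>_suffix_less \<tau>_reflect_suffix_less by blast

text \<open>The value of \<tau> exceeds 1 at \<open>q0\<close>, since \<tau> exceeds \<alpha>, and
  is at most 1 at \<open>m + 1\<close>; the intermediate value theorem gives \<open>q1\<close>. The
  bounds on shifts of \<tau> certify it as quasi-greedy and univoque there.\<close>

lemma next_univoque_base:
  assumes m: "1 \<le> m" and q0: "real (m div 2 + 1) < q0" "q0 \<le> real m + 1" "quasi_greedy m q0 = \<alpha>"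
  obtains q1 where "q0 < q1" "q1 \<le> real m + 1" "quasi_greedy m q1 = \<tau>" "q1 \<in> univoque_bases m"
    "{q0<..<q1} \<inter> univoque_bases m = {}"
proof -
  have q01: "1 < q0" using q0(1) by simp
  note P = quasi_greedy_props[OF q01 q0(2), unfolded q0(3)]
  have "expansion_value q0 \<alpha> < expansion_value q0 \<tau>"
    by (rule expansion_value_mono_lex(2)[OF P(1) \<tau>_digits q01 \<alpha>_less_fun_\<tau> P(4) \<tau>_infinite])
  then have gt: "1 < expansion_value q0 \<tau>" using P(2) by simp
  have "expansion_value (real m + 1) \<tau> \<le> real m / (real m + 1 - 1)"
    by (rule expansion_value_le[OF \<tau>_digits]) (use m in simp)
  then have le: "expansion_value (real m + 1) \<tau> \<le> 1" using m by simp
  have "continuous_on {q0..real m + 1} (\<lambda>q. expansion_value q \<tau>)"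
    by (rule continuous_on_subset[OF continuous_on_expansion_value[OF \<tau>_digits q01]]) auto
  then obtain q1 where q1: "q0 \<le> q1" "q1 \<le> real m + 1" "expansion_value q1 \<tau> = 1"
    using IVT2'[of "\<lambda>q. expansion_value q \<tau>" "real m + 1" 1 q0] le gt q0(2) by auto
  then have lt: "q0 < q1" using gt by (metis less_irrefl order_le_less)
  have q11: "1 < q1" using lt q01 by simp
  have lex: "\<not> less_fun \<tau> (suffix k \<tau>)" for k
    by (cases "k = 0") (use less_fun_irrefl \<tau>_suffix_less less_fun_asym in auto)
  have qg: "quasi_greedy m q1 = \<tau>"
    by (rule quasi_greedy_unique[OF q11 \<tau>_digits q1(3) \<tau>_infinite])
      (rule expansion_value_le_1(1)[OF \<tau>_digits \<tau>_digits q11 q1(3) lex lex])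
  have "q1 \<in> univoque_bases m"
    unfolding univoque_bases_iff qg using q11 q1(2) \<tau>_lex_univoque by blast
  moreover have "{q0<..<q1} \<inter> univoque_bases m = {}"
  proof (rule ccontr)
    assume "\<not> ?thesis"
    then obtain q where q: "q0 < q" "q < q1" "q \<in> univoque_bases m" by auto
    have q': "1 < q" "q \<le> real m + 1" using q q01 q1(2) by auto
    have "real (m div 2 + 1) < q" using q(1) q0(1) by simp
    then have "m < 2 * quasi_greedy m q 0" using quasi_greedy_first_digit q'(2) m by blast
    then have "less_fun (reflect_seq m (suffix k (quasi_greedy m q))) (quasi_greedy m q)" for k
      using reflect_suffix_less_of_lex_univoque quasi_greedy_props(1)[OF q'] q(3) univoque_bases_iff by blast
    then show False
      using no_univoque_between[of "quasi_greedy m q"] quasi_greedy_strict_mono[OF q01 q(1) q'(2)] q0(3)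
        quasi_greedy_strict_mono[OF q'(1) q(2) q1(2)] qg quasi_greedy_props(1)[OF q']
        quasi_greedy_suffix_le[OF q'] by metis
  qed
  ultimately show ?thesis using that lt q1(2) qg by blast
qed

end

section \<open>Endpoints of the component and conclusion\<close>

lemma interval_component_endpoints:
  fixes l u :: real
  assumes "{l<..<u} \<in> components S"
  shows "l < u" "{l<..<u} \<subseteq> S" "l \<notin> S" "u \<notin> S"
proof -
  have "{l<..<u} \<noteq> {}" using assms by (rule in_components_nonempty)
  then show lu: "l < u" by simp
  show sub: "{l<..<u} \<subseteq> S" using assms by (rule in_components_subset)
  have meet: "{l<..<u} \<inter> {l..<u} \<noteq> {}" "{l<..<u} \<inter> {l<..u} \<noteq> {}"
    using dense[OF lu] by fastforce+
  show "l \<notin> S"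
  proof
    assume "l \<in> S"
    then have "{l..<u} \<subseteq> S" using sub by (auto simp: less_le)
    then have "{l..<u} \<subseteq> {l<..<u}" using components_maximal[OF assms _ _ meet(1)] by auto
    then show False using lu by auto
  qed
  show "u \<notin> S"
  proof
    assume "u \<in> S"
    then have "{l<..u} \<subseteq> S" using sub by (auto simp: less_le)
    then have "{l<..u} \<subseteq> {l<..<u}" using components_maximal[OF assms _ _ meet(2)] by auto
    then show False using lu by auto
  qed
qed

text \<open>If the last letter were \<open>m\<close>, the shift beginning with it would be at least
  the whole sequence, hence equal to it. Minimality forces period 1, so all digits are
  \<open>m\<close> and \<open>q = m + 1\<close>.\<close>

lemma periodic_quasi_greedy_last_digit:
  assumes q: "1 < q" "q < real m + 1" and a: "a \<noteq> []" "quasi_greedy m q = a\<^sup>\<omega>"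
    and min: "\<And>k. 0 < k \<Longrightarrow> k < length a \<Longrightarrow> suffix k (a\<^sup>\<omega>) \<noteq> a\<^sup>\<omega>"
  shows "last a < m"
proof (rule ccontr)
  let ?\<alpha> = "a\<^sup>\<omega>" and ?k = "length a - 1"
  have qm: "q \<le> real m + 1" using q(2) by simp
  note P = quasi_greedy_props[OF q(1) qm, unfolded a(2)]
  have k: "Suc ?k = length a" using a(1) by simp
  assume "\<not> last a < m"
  then have top: "?\<alpha> ?k = m"
    using digit_seqsD[OF P(1), of ?k] a(1) by (simp add: last_conv_nth)
  have "suffix (Suc ?k) ?\<alpha> = ?\<alpha>" unfolding k using a(1) by (simp add: fun_eq_iff)
  then have "\<not> less_fun (suffix ?k ?\<alpha>) ?\<alpha>"
    using not_less_fun_suffix_1[of "suffix ?k ?\<alpha>" m] P(1) top by (simp only: suffix_digit_seqs suffix_nth suffix_suffix) simp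
  then have "suffix ?k ?\<alpha> = ?\<alpha>"
    using quasi_greedy_suffix_le[OF q(1) qm, of ?k] a(2) less_fun_linear by metis
  then have "?k = 0" using min[of ?k] k by (metis gr0I lessI)
  then have "?\<alpha> i = m" for i using top k by (metis Suc_eq_plus1 add_0 iter_nth lessI mod_less_divisor less_Suc0 mod_0)
  then have "?\<alpha> = (\<lambda>_. m)" by blast
  then have "expansion_value q ?\<alpha> = real m / (q - 1)"
    using geometric_digit_sums[OF q(1), of m] by (simp add: expansion_value_def sums_iff)
  then show False using P(2) q by (simp add: field_simps)
qed

theorem theorem5p5:
  fixes m M n :: nat and q0 q0star :: real and a :: "nat list" and b :: "nat word"
  assumes "m \<ge> 1"
    and "M = m div 2 + 1"
    and "{q0<..<q0star} \<in> components ({real M<..real m + 1} - closure (univoque_bases m))"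
    and "q0 > real M"
    and "a \<noteq> []" and "quasi_greedy m q0 = a\<^sup>\<omega>"
    and "length a = n" and "n = smallest_period (quasi_greedy m q0)"
    and "b \<in> digit_seqs m"
  shows "b \<in> unique_expansions m q0star - unique_expansions m q0 \<longleftrightarrow>
         has_form m a b \<or> has_form m a (reflect_seq m b)"
proof -
  let ?U = "univoque_bases m" and ?\<alpha> = "a\<^sup>\<omega>"
  note C = interval_component_endpoints[OF assms(3)]
  have sub: "{q0<..<q0star} \<inter> closure ?U = {}" "{q0<..<q0star} \<subseteq> {..real m + 1}"
    using C(2) by auto
  have star: "q0star \<le> real m + 1"
  proof (rule dense_le_bounded[OF C(1)])
    fix x assume "q0 < x" "x < q0star"
    then show "x \<le> real m + 1" using sub(2) by auto
  qed
  \<comment> \<open>The endpoints lie in the half-open interval but not in the open-closed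
    difference set, so they must lie in the closure.\<close>
  have cl: "q0 \<in> closure ?U" "q0star \<in> closure ?U"
    using C(1,3,4) star assms(4) by auto
  have q0: "real (m div 2 + 1) < q0" "1 < q0" "q0 < real m + 1" "q0 \<le> real m + 1"
    using assms(2,4) star C(1) by auto
  note P = quasi_greedy_props[OF q0(2,4), unfolded assms(6)]
  have min: "suffix k ?\<alpha> \<noteq> ?\<alpha>" if "0 < k" "k < length a" for k
  proof
    assume "suffix k ?\<alpha> = ?\<alpha>"
    then have "\<forall>i. ?\<alpha> (i + k) = ?\<alpha> i" by (metis add.commute suffix_nth)
    then have "smallest_period ?\<alpha> \<le> k"
      unfolding smallest_period_def using that(1) by (intro Least_le) blast
    then show False using that(2) assms(6,7,8) by simp
  qed
  have gap: "{q0<..<q0star} \<inter> ?U = {}" using sub(1) closure_subset by blast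
  interpret admissible_word m a
  proof
    show "m < 2 * a ! 0"
      using quasi_greedy_first_digit[OF q0(1,4) assms(1)] assms(5,6) by simp
    show "less_fun (suffix k ?\<alpha>) ?\<alpha>" if "0 < k" "k < length a" for k
      using quasi_greedy_suffix_le[OF q0(2,4), of k] min[OF that] assms(6) less_fun_linear by metis
    show "less_fun (reflect_seq m (suffix k ?\<alpha>)) ?\<alpha>" for k
      using quasi_greedy_reflect_suffix_less[OF assms(1) q0(1,4) cl(1) C(1) gap] assms(6) by simp
  qed (use assms(5) P(1) periodic_quasi_greedy_last_digit[OF q0(2,3) assms(5,6) min] in auto)
  obtain q1 where q1: "q0 < q1" "q1 \<le> real m + 1" "quasi_greedy m q1 = \<tau>" "q1 \<in> ?U"
    "{q0<..<q1} \<inter> ?U = {}"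
    using next_univoque_base[OF assms(1) q0(1,4) assms(6)] .
  \<comment> \<open>\<open>q0star\<close> equals \<open>q1\<close>: a univoque base cannot lie in
    the component, and the open interval up to \<open>q1\<close>, free of univoque bases, contains
    none of their limits.\<close>
  have "\<not> q1 < q0star" using gap q1(1,4) by auto
  moreover have "\<not> q0star < q1"
  proof
    assume "q0star < q1"
    then have "q0star \<in> {q0<..<q1}" using C(1) by simp
    moreover have "{q0<..<q1} \<inter> closure ?U = {}"
      using q1(5) open_Int_closure_eq_empty[OF open_greaterThanLessThan] by blast
    ultimately show False using cl(2) by blast
  qed
  ultimately have eq: "q0star = q1" by simp
  have "b \<in> unique_expansions m q0star \<longleftrightarrow> lex_univoque m \<tau> b"
    using unique_expansions_iff[of q0star m b] assms(9) star C(1) q0(2) q1(3) eq by simp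
  moreover have "b \<in> unique_expansions m q0 \<longleftrightarrow> lex_univoque m ?\<alpha> b"
    using unique_expansions_iff[OF q0(2,4), of b] assms(6,9) by simp
  ultimately show ?thesis using lex_univoque_difference_iff[OF assms(9)] by simp
qed

end
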